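(* The set \[\mathbf{Sel}=\{E\in F(\mathcal{N}^2): E \text{ is an equivalence relation on } \mathcal{N} \text{ admitting a Borel selector}\}\] is $\boldsymbol{\Sigma}^1_2$-complete.
   Context: $F(\mathcal{N}^2)$ is the Effros Borel space of closed subsets of $\mathcal{N}^2$, where $\mathcal{N}$ is Baire space. A Borel selector for an equivalence relation $E$ on $\mathcal{N}$ is a Borel map $s:\mathcal{N}\to\mathcal{N}$ with $s(x)\,E\,x$ for all $x$ and $xEy\Rightarrow s(x)=s(y)$. *)

theory Defs
  imports "HOL-Analysis.Analysis"
begin

text \<open>Baire space: the topology on this type is the product of the discrete topologies.\<close>

type_synonym baire = "nat \<Rightarrow> nat"

text \<open>As usual in descriptive set theory, a standard Borel space is given by its carrier and its
  \<open>\<sigma>\<close>-algebra only; the measure function that the type \<^typ>\<open>'a measure\<close> carries is irrelevant below.\<close>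

definition standard_borel :: "'a measure \<Rightarrow> bool" where
  "standard_borel X \<longleftrightarrow>
     (\<exists>T. completely_metrizable_space T \<and> separable_space T \<and>
          topspace T = space X \<and> sets X = sigma_sets (space X) {U. openin T U})"

text \<open>The projective hierarchy, by projection along Baire space:
  \<open>\<Sigma>\<^sup>1\<^sub>1\<close> sets are the projections of Borel sets, and \<open>\<Sigma>\<^sup>1\<^sub>2\<close> sets the projections of \<open>\<Pi>\<^sup>1\<^sub>1\<close> sets.\<close>

definition Sigma11 :: "'a measure \<Rightarrow> 'a set set" where
  "Sigma11 X = {fst ` B | B. B \<in> sets (X \<Otimes>\<^sub>M (borel :: baire measure))}"

definition Pi11 :: "'a measure \<Rightarrow> 'a set set" where
  "Pi11 X = {space X - A | A. A \<in> Sigma11 X}"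

definition Sigma12 :: "'a measure \<Rightarrow> 'a set set" where
  "Sigma12 X = {fst ` B | B. B \<in> Pi11 (X \<Otimes>\<^sub>M (borel :: baire measure))}"

text \<open>Completeness with respect to Borel reductions from arbitrary standard Borel spaces \<open>Y\<close>.
  HOL cannot quantify over the type of the points of \<open>Y\<close> inside a formula, so it is a parameter;
  a theorem stated for a type variable there covers all standard Borel spaces.\<close>

definition Sigma12_complete :: "'y itself \<Rightarrow> 'a measure \<Rightarrow> 'a set \<Rightarrow> bool" where
  "Sigma12_complete _ X A \<longleftrightarrow>
     A \<in> Sigma12 X \<and>
     (\<forall>(Y :: 'y measure) B. standard_borel Y \<and> B \<in> Sigma12 Y \<longrightarrow>
        (\<exists>f \<in> Y \<rightarrow>\<^sub>M X. f -` A \<inter> space Y = B))"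

text \<open>The points of the Effros Borel space are all closed sets, the empty set included.\<close>

definition effros :: "'a::topological_space set measure" where
  "effros = sigma {F. closed F} {{F. closed F \<and> F \<inter> U \<noteq> {}} | U. open U}"

definition borel_selector :: "(baire \<times> baire) set \<Rightarrow> (baire \<Rightarrow> baire) \<Rightarrow> bool" where
  "borel_selector E s \<longleftrightarrow>
     s \<in> borel \<rightarrow>\<^sub>M borel \<and>
     (\<forall>x. (s x, x) \<in> E) \<and>
     (\<forall>x y. (x, y) \<in> E \<longrightarrow> s x = s y)"

definition Sel :: "(baire \<times> baire) set set" where
  "Sel = {E \<in> space effros. equiv UNIV E \<and> (\<exists>s. borel_selector E s)}"

end

theory Submission
  imports Defs "HOL-Library.Nat_Bijection"
begin

text \<open>Upper bound: \<open>E\<close> has a Borel selector iff some code of a family of Borel sets is well-founded and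
  every evaluation of it describes a selector of \<open>E\<close>; the part after the first quantifier is \<open>\<Pi>\<^sup>1\<^sub>1\<close>.

  Hardness: write \<open>y \<in> B\<close> as: some tree \<open>T(y, z)\<close> is well-founded. Let \<open>F\<^sub>y\<close> be the closed set of all
  \<open>(x, z, \<phi>)\<close> such that \<open>\<phi>\<close> is a monotone map of \<open>T(y, z)\<close> into the tree \<open>x\<close>, and identify points of \<open>F\<^sub>y\<close>
  that have the same \<open>x\<close>. If \<open>y \<notin> B\<close>, then \<open>F\<^sub>y\<close> projects onto the set of ill-founded trees; a Borel
  selector would make this projection Borel, as in the Lusin-Souslin theorem, which it is not. If
  \<open>y \<in> B\<close>, take \<open>z\<^sub>0\<close> such that \<open>T(y, z\<^sub>0)\<close> has least rank. Every \<open>x\<close> in the projection then admits a map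
  of \<open>T(y, z\<^sub>0)\<close>, and, as this tree is fixed and well-founded, such a map can be chosen in a Borel way.
  Points that are eventually 0 are added to \<open>F\<^sub>y\<close> to make the relation depend on \<open>y\<close> in a Borel way;
  there are only countably many of them, so they do not matter for selectors.\<close>

section \<open>Baire space\<close>

text \<open>Initial segments are reversed lists, so that extending one by a value is a \<open>Cons\<close>.\<close>

primrec res :: "(nat \<Rightarrow> 'a) \<Rightarrow> nat \<Rightarrow> 'a list" where
  "res x 0 = []"
| "res x (Suc n) = x n # res x n"

lemma length_res [simp]: "length (res x n) = n"
  by (induction n) auto

lemma res_eq_iff: "res x n = res y n \<longleftrightarrow> (\<forall>i<n. x i = y i)"
  by (induction n) (auto simp: less_Suc_eq)

lemma res_eq_mono: "res x n = res y n \<Longrightarrow> m \<le> n \<Longrightarrow> res x m = res y m"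
  by (auto simp: res_eq_iff)

lemma res_eqI: "(\<And>n. res x n = res y n) \<Longrightarrow> x = y"
  by (metis ext lessI res_eq_iff)

lemma res_extend: "\<exists>x. res x (length s) = s \<and> (\<forall>i\<ge>length s. x i = a)"
proof (induction s)
  case (Cons b s)
  then obtain x where x: "res x (length s) = s" "\<forall>i\<ge>length s. x i = a" by blast
  define y where "y = x(length s := b)"
  have "res y (length s) = res x (length s)"
    unfolding res_eq_iff y_def by auto
  then have "res y (length (b # s)) = b # s" using x by (simp add: y_def)
  moreover have "\<forall>i\<ge>length (b # s). y i = a" using x by (auto simp: y_def)
  ultimately show ?case by blast
qed auto

lemma res_coherent:
  assumes "\<And>n. length (u n) = n" "\<And>n. tl (u (Suc n)) = u n"
  obtains x where "\<And>n. res x n = u n"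
proof
  fix n show "res (\<lambda>n. hd (u (Suc n))) n = u n"
  proof (induction n)
    case 0 then show ?case using assms(1)[of 0] by simp
  next
    case (Suc n)
    then show ?case using assms(1)[of "Suc n"] assms(2)[of n] by (cases "u (Suc n)") auto
  qed
qed

lemma res_map: "res (\<lambda>n. f (x n)) n = map f (res x n)"
  by (induction n) auto

lemma open_res: "open {x :: baire. P (res x n)}"
proof -
  have "open {x :: baire. res x n = s}" for s
  proof (induction n arbitrary: s)
    case (Suc n)
    show ?case
    proof (cases s)
      case (Cons a t)
      have "open ((\<lambda>x::baire. x n) -` {a})"
        by (rule open_vimage) (auto intro: open_discrete)
      then have "open ((\<lambda>x::baire. x n) -` {a} \<inter> {x. res x n = t})"
        using Suc by blast
      also have "(\<lambda>x::baire. x n) -` {a} \<inter> {x. res x n = t} = {x. res x (Suc n) = s}"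
        using Cons by auto
      finally show ?thesis .
    qed auto
  qed (auto simp: open_Collect_const)
  then have "open (\<Union>s\<in>{s. P s}. {x :: baire. res x n = s})" by blast
  also have "(\<Union>s\<in>{s. P s}. {x :: baire. res x n = s}) = {x. P (res x n)}" by auto
  finally show ?thesis .
qed

lemma open_contains_res:
  assumes "open U" "(x :: baire) \<in> U"
  obtains n where "\<And>y. res y n = res x n \<Longrightarrow> y \<in> U"
proof -
  have "openin (product_topology (\<lambda>i. euclidean) UNIV) U"
    using assms(1) by (simp add: open_fun_def)
  from product_topology_open_contains_basis[OF this assms(2)]
  obtain X where X: "x \<in> (\<Pi>\<^sub>E i\<in>UNIV. X i)" "finite {i. X i \<noteq> UNIV}" "(\<Pi>\<^sub>E i\<in>UNIV. X i) \<subseteq> U"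
    by auto
  obtain n where n: "\<And>i. X i \<noteq> UNIV \<Longrightarrow> i < n"
    using X(2) by (metis (mono_tags, lifting) finite_nat_set_iff_bounded mem_Collect_eq)
  have "y \<in> U" if "res y n = res x n" for y
  proof -
    have "y i \<in> X i" for i
      using that X(1) n[of i] by (cases "X i = UNIV") (auto simp: res_eq_iff PiE_iff)
    then show ?thesis using X(3) by (auto simp: PiE_iff)
  qed
  then show ?thesis using that by blast
qed

lemma open_contains_res2:
  assumes "open U" "(x, y) \<in> (U :: (baire \<times> baire) set)"
  obtains n where "\<And>x' y'. res x' n = res x n \<Longrightarrow> res y' n = res y n \<Longrightarrow> (x', y') \<in> U"
proof -
  obtain A B where AB: "open A" "open B" "(x, y) \<in> A \<times> B" "A \<times> B \<subseteq> U"
    using open_prod_elim[OF assms] by metis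
  obtain n where n: "\<And>x'. res x' n = res x n \<Longrightarrow> x' \<in> A"
    using open_contains_res[OF AB(1), of x] AB(3) by auto
  obtain m where m: "\<And>x'. res x' m = res y m \<Longrightarrow> x' \<in> B"
    using open_contains_res[OF AB(2), of y] AB(3) by auto
  have "(x', y') \<in> U" if "res x' (max n m) = res x (max n m)" "res y' (max n m) = res y (max n m)" for x' y'
    using AB(4) n[of x'] m[of y'] res_eq_mono[OF that(1), of n] res_eq_mono[OF that(2), of m] by auto
  then show ?thesis by (rule that)
qed

text \<open>Continuity into a discrete space, phrased through initial segments so that values such
  as lists and truth values need no topology.\<close>

definition loc_const :: "(baire \<Rightarrow> 'b) \<Rightarrow> bool" where
  "loc_const f \<longleftrightarrow> (\<forall>x. \<exists>n. \<forall>y. res y n = res x n \<longrightarrow> f y = f x)"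

lemma loc_const_const: "loc_const (\<lambda>x. c)"
  by (auto simp: loc_const_def)

lemma loc_const_res: "loc_const (\<lambda>x. P (res x n))"
  unfolding loc_const_def by (intro allI exI[of _ n]) simp

lemma loc_const_coord: "loc_const (\<lambda>x. x i)"
  unfolding loc_const_def by (intro allI exI[of _ "Suc i"]) simp

text \<open>On a neighbourhood where \<open>g\<close> keeps its value, only one index of
  \<open>F\<close> matters. This covers segments whose length, and tree nodes whose address, depends
  on the point.\<close>

lemma loc_const_app:
  assumes "\<And>j. loc_const (\<lambda>x. F x j)" "loc_const g"
  shows "loc_const (\<lambda>x. F x (g x))"
  unfolding loc_const_def
proof
  fix x
  obtain n m where "\<forall>y. res y n = res x n \<longrightarrow> F y (g x) = F x (g x)" "\<forall>y. res y m = res x m \<longrightarrow> g y = g x"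
    using assms unfolding loc_const_def by metis
  then show "\<exists>n. \<forall>y. res y n = res x n \<longrightarrow> F y (g y) = F x (g x)"
    by (intro exI[of _ "max n m"]) (metis max.cobounded1 max.cobounded2 res_eq_mono)
qed

lemma loc_const_comp: "loc_const f \<Longrightarrow> loc_const (\<lambda>x. h (f x))"
  by (auto simp: loc_const_def) metis

lemma loc_const_comp2: "loc_const f \<Longrightarrow> loc_const g \<Longrightarrow> loc_const (\<lambda>x. h (f x) (g x))"
  by (rule loc_const_app[where F = "\<lambda>x b. h (f x) b"]) (rule loc_const_comp)

lemma loc_const_map_res:
  assumes "\<And>i. loc_const (\<lambda>x. F x i)"
  shows "loc_const (\<lambda>x. res (F x) n)"
  by (induction n) (auto intro: loc_const_const loc_const_comp2[OF assms])

lemma open_loc_const: "loc_const P \<Longrightarrow> open {x. P x}"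
proof (subst open_subopen, clarify)
  fix x assume "loc_const P" "P x"
  then obtain n where "\<forall>y. res y n = res x n \<longrightarrow> P y" unfolding loc_const_def by blast
  then show "\<exists>T. open T \<and> x \<in> T \<and> T \<subseteq> {x. P x}"
    by (intro exI[of _ "{y. res y n = res x n}"]) (auto intro: open_res)
qed

lemma closed_loc_const: "loc_const P \<Longrightarrow> closed {x. P x}"
  using open_loc_const[of "\<lambda>x. \<not> P x"] by (simp add: closed_def Compl_eq loc_const_comp[where h = Not])

lemma continuous_iff_loc_const:
  fixes f :: "baire \<Rightarrow> baire"
  shows "continuous_on UNIV f \<longleftrightarrow> (\<forall>i. loc_const (\<lambda>x. f x i))"
proof
  assume f: "continuous_on UNIV f"
  show "\<forall>i. loc_const (\<lambda>x. f x i)"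
    unfolding loc_const_def
  proof (intro allI)
    fix i x
    have "open (f -` {y. res y (Suc i) = res (f x) (Suc i)})"
      by (rule open_vimage[OF open_res[of "\<lambda>s. s = _"] f])
    from open_contains_res[OF this, of x]
    obtain n where n: "\<And>y. res y n = res x n \<Longrightarrow> y \<in> f -` {y. res y (Suc i) = res (f x) (Suc i)}" by blast
    have "f y i = f x i" if "res y n = res x n" for y using n[OF that] by simp
    then show "\<exists>n. \<forall>y. res y n = res x n \<longrightarrow> f y i = f x i" by blast
  qed
next
  assume f: "\<forall>i. loc_const (\<lambda>x. f x i)"
  show "continuous_on UNIV f"
  proof (rule continuous_on_coordinatewise_then_product)
    fix i
    have "open ((\<lambda>x. f x i) -` B)" for B
      using open_loc_const[of "\<lambda>x. f x i \<in> B"] loc_const_comp[of "\<lambda>x. f x i" "\<lambda>a. a \<in> B"] f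
      by (simp add: vimage_def)
    then show "continuous_on UNIV (\<lambda>x. f x i)" by (simp add: continuous_on_open_vimage)
  qed
qed

lemma continuous_res:
  assumes "continuous_on UNIV (f :: baire \<Rightarrow> baire)"
  obtains n where "\<And>y. res y n = res x n \<Longrightarrow> res (f y) m = res (f x) m"
proof -
  have "loc_const (\<lambda>x. res (f x) m)"
    using assms by (intro loc_const_map_res) (auto simp: continuous_iff_loc_const)
  then show ?thesis using that by (auto simp: loc_const_def)
qed

lemma closed_mem_res:
  assumes "closed (C :: baire set)" "\<And>n. \<exists>y\<in>C. res y n = res x n"
  shows "x \<in> C"
proof (rule ccontr)
  assume "x \<notin> C"
  then obtain n where "\<And>y. res y n = res x n \<Longrightarrow> y \<in> - C"
    using open_contains_res[of "- C" x] assms(1) by (auto simp: closed_def)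
  then show False using assms(2)[of n] by auto
qed

section \<open>Borel maps into Baire space\<close>

lemma measurable_coord [measurable]: "(\<lambda>x::baire. x i) \<in> borel \<rightarrow>\<^sub>M count_space UNIV"
  using borel_measurable_continuous_onI[OF continuous_on_product_coordinates[where 'a = nat and 'b = nat], of i]
  by (simp only: measurable_cong_sets[OF refl sets_borel_eq_count_space])

lemma measurable_baire_iff:
  "f \<in> M \<rightarrow>\<^sub>M (borel :: baire measure) \<longleftrightarrow> (\<forall>i. (\<lambda>x. f x i) \<in> M \<rightarrow>\<^sub>M count_space UNIV)"
proof
  assume "\<forall>i. (\<lambda>x. f x i) \<in> M \<rightarrow>\<^sub>M count_space UNIV"
  then have "\<And>i. (\<lambda>x. f x i) \<in> borel_measurable M"
    by (simp only: measurable_cong_sets[OF refl sets_borel_eq_count_space])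
  then show "f \<in> M \<rightarrow>\<^sub>M borel" by (rule measurable_coordinatewise_then_product)
qed (auto intro: measurable_compose[OF _ measurable_coord])

lemma measurable_res [measurable]: "(\<lambda>x::baire. res x n) \<in> borel \<rightarrow>\<^sub>M count_space UNIV"
proof -
  have "(\<lambda>x. res x n) -` {s} \<inter> space borel \<in> sets (borel :: baire measure)" for s
    using open_res[of "\<lambda>t. t = s" n] by (simp add: vimage_def)
  then show ?thesis
    by (subst measurable_count_space_eq2_countable) auto
qed

text \<open>The coordinatewise pairing is a homeomorphism of \<open>N\<^sup>2\<close> with \<open>N\<close>, so that subsets of powers
  of Baire space become subsets of Baire space.\<close>

definition pr :: "baire \<Rightarrow> baire \<Rightarrow> baire" where "pr x w = (\<lambda>n. prod_encode (x n, w n))"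
definition fs :: "baire \<Rightarrow> baire" where "fs p = (\<lambda>n. fst (prod_decode (p n)))"
definition sn :: "baire \<Rightarrow> baire" where "sn p = (\<lambda>n. snd (prod_decode (p n)))"
definition col :: "baire \<Rightarrow> nat \<Rightarrow> baire" where "col w i = (\<lambda>n. w (prod_encode (i, n)))"
definition cols :: "(nat \<Rightarrow> baire) \<Rightarrow> baire" where
  "cols v = (\<lambda>k. v (fst (prod_decode k)) (snd (prod_decode k)))"

lemma fs_pr [simp]: "fs (pr x w) = x" by (simp add: fs_def pr_def)
lemma sn_pr [simp]: "sn (pr x w) = w" by (simp add: sn_def pr_def)
lemma pr_fs_sn [simp]: "pr (fs p) (sn p) = p" by (simp add: fs_def sn_def pr_def)
lemma col_cols [simp]: "col (cols v) i = v i" by (simp add: col_def cols_def)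

lemma continuous_fs: "continuous_on UNIV fs"
  unfolding continuous_iff_loc_const fs_def
  by (intro allI loc_const_comp[OF loc_const_coord, where h = "\<lambda>a. fst (prod_decode a)"])
lemma continuous_sn: "continuous_on UNIV sn"
  unfolding continuous_iff_loc_const sn_def
  by (intro allI loc_const_comp[OF loc_const_coord, where h = "\<lambda>a. snd (prod_decode a)"])
lemma continuous_col: "continuous_on UNIV (\<lambda>w. col w i)"
  unfolding continuous_iff_loc_const col_def by (intro allI loc_const_coord)

lemma continuous_pr:
  "continuous_on UNIV f \<Longrightarrow> continuous_on UNIV g \<Longrightarrow> continuous_on UNIV (\<lambda>x::baire. pr (f x) (g x))"
  unfolding continuous_iff_loc_const pr_def
  by (simp add: loc_const_comp2[where h = "\<lambda>a b. prod_encode (a, b)"])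

lemma measurable_fs [measurable]: "fs \<in> borel \<rightarrow>\<^sub>M borel"
  by (rule borel_measurable_continuous_onI[OF continuous_fs])
lemma measurable_sn [measurable]: "sn \<in> borel \<rightarrow>\<^sub>M borel"
  by (rule borel_measurable_continuous_onI[OF continuous_sn])
lemma measurable_col [measurable]: "(\<lambda>w. col w i) \<in> borel \<rightarrow>\<^sub>M borel"
  by (rule borel_measurable_continuous_onI[OF continuous_col])
lemma measurable_pr [measurable]:
  assumes [measurable]: "f \<in> M \<rightarrow>\<^sub>M borel" "g \<in> M \<rightarrow>\<^sub>M borel"
  shows "(\<lambda>x. pr (f x) (g x)) \<in> M \<rightarrow>\<^sub>M borel"
  unfolding measurable_baire_iff pr_def by measurable
lemma measurable_cols:
  assumes [measurable]: "\<And>i. f i \<in> M \<rightarrow>\<^sub>M borel"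
  shows "(\<lambda>x. cols (\<lambda>i. f i x)) \<in> M \<rightarrow>\<^sub>M borel"
  unfolding measurable_baire_iff cols_def by measurable

section \<open>Analytic sets\<close>

text \<open>Stands in for an embedding of \<open>M\<close> into Baire space: a measurable subset of
  the product involves only countably many measurable subsets of \<open>M\<close>, and
  \<open>g\<close> records to which of them a point belongs.\<close>

lemma sets_pair_borel_pullback:
  assumes "Q \<in> sets (M \<Otimes>\<^sub>M (borel :: baire measure))"
  shows "\<exists>g \<in> M \<rightarrow>\<^sub>M borel. \<exists>Q' \<in> sets borel. \<forall>m\<in>space M. \<forall>z. (m, z) \<in> Q \<longleftrightarrow> pr (g m) z \<in> Q'"
  using assms unfolding sets_pair_measure
proof (induction rule: sigma_sets.induct)
  case (Basic X)
  then obtain a b where ab: "X = a \<times> b" "a \<in> sets M" "b \<in> sets borel" by auto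
  define g :: "_ \<Rightarrow> baire" where "g m = (\<lambda>_. if m \<in> a then 1 else 0)" for m
  note [measurable] = ab(2,3)
  have "g \<in> M \<rightarrow>\<^sub>M borel" unfolding measurable_baire_iff g_def by measurable
  moreover have "{q \<in> space borel. fs q 0 = 1 \<and> sn q \<in> b} \<in> sets borel" by measurable
  ultimately show ?case
    by (intro bexI[of _ g] bexI[of _ "{q \<in> space borel. fs q 0 = 1 \<and> sn q \<in> b}"]) (auto simp: ab g_def)
next
  case Empty
  show ?case by (intro bexI[of _ "\<lambda>_. undefined"] bexI[of _ "{}"]) auto
next
  case (Compl X)
  then obtain g Q' where "g \<in> M \<rightarrow>\<^sub>M borel" "Q' \<in> sets borel"
    "\<forall>m\<in>space M. \<forall>z. (m, z) \<in> X \<longleftrightarrow> pr (g m) z \<in> Q'" by blast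
  then show ?case by (intro bexI[of _ g] bexI[of _ "- Q'"]) auto
next
  case (Union X)
  then have "\<forall>i. \<exists>g Q'. g \<in> M \<rightarrow>\<^sub>M borel \<and> Q' \<in> sets borel \<and> (\<forall>m\<in>space M. \<forall>z. (m, z) \<in> X i \<longleftrightarrow> pr (g m) z \<in> Q')"
    by blast
  from choice[OF this] obtain g where "\<forall>i. \<exists>Q'. g i \<in> M \<rightarrow>\<^sub>M borel \<and> Q' \<in> sets borel \<and> (\<forall>m\<in>space M. \<forall>z. (m, z) \<in> X i \<longleftrightarrow> pr (g i m) z \<in> Q')"
    by blast
  from choice[OF this] obtain Q' where g: "\<And>i. g i \<in> M \<rightarrow>\<^sub>M borel" and Q': "\<And>i. Q' i \<in> sets borel"
    and X: "\<And>i m z. m \<in> space M \<Longrightarrow> (m, z) \<in> X i \<longleftrightarrow> pr (g i m) z \<in> Q' i" by blast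
  note [measurable] = Q'
  have "(\<lambda>m. cols (\<lambda>i. g i m)) \<in> M \<rightarrow>\<^sub>M borel" by (rule measurable_cols[OF g])
  moreover have "{q \<in> space borel. \<exists>i. pr (col (fs q) i) (sn q) \<in> Q' i} \<in> sets borel" by measurable
  ultimately show ?case
    by (intro bexI[of _ "\<lambda>m. cols (\<lambda>i. g i m)"]
      bexI[of _ "{q \<in> space borel. \<exists>i. pr (col (fs q) i) (sn q) \<in> Q' i}"]) (use X in auto)
qed

text \<open>Analytic sets as projections of closed subsets of the plane, the plane being folded into
  Baire space by \<open>pr\<close>.\<close>

definition suslin :: "baire set \<Rightarrow> bool" where
  "suslin A \<longleftrightarrow> (\<exists>C. closed C \<and> (\<forall>x. x \<in> A \<longleftrightarrow> (\<exists>w. pr x w \<in> C)))"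

lemma closed_vimage_UNIV:
  "closed C \<Longrightarrow> continuous_on UNIV f \<Longrightarrow> closed {x. f x \<in> C}"
  using closed_vimage[of C f] by (simp add: vimage_def)

lemma suslin_closed: "closed A \<Longrightarrow> suslin A"
  unfolding suslin_def
  by (intro exI[of _ "{q. fs q \<in> A}"]) (auto intro!: closed_vimage_UNIV continuous_fs)

text \<open>The witness is a bound \<open>w 0\<close> such that all points agreeing with
  \<open>x\<close> up to this length lie in \<open>A\<close>. This condition on the pair is locally
  constant, hence closed.\<close>

lemma suslin_open:
  assumes "open A"
  shows "suslin A"
  unfolding suslin_def
proof (intro exI[of _ "{q. \<forall>y. res y (sn q 0) = res (fs q) (sn q 0) \<longrightarrow> y \<in> A}"] conjI allI)
  have fs: "loc_const (\<lambda>q. fs q i)" for i using continuous_fs by (simp add: continuous_iff_loc_const)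
  have sn: "loc_const (\<lambda>q. sn q i)" for i using continuous_sn by (simp add: continuous_iff_loc_const)
  have "loc_const (\<lambda>q. \<forall>y. res y (sn q 0) = res (fs q) (sn q 0) \<longrightarrow> y \<in> A)"
    by (rule loc_const_comp2[where h = "\<lambda>s k. \<forall>y. res y k = s \<longrightarrow> y \<in> A"])
      (rule loc_const_app[where F = "\<lambda>q. res (fs q)"], rule loc_const_map_res[OF fs], (rule sn)+)
  then show "closed {q. \<forall>y. res y (sn q 0) = res (fs q) (sn q 0) \<longrightarrow> y \<in> A}"
    by (rule closed_loc_const)
next
  fix x
  show "x \<in> A \<longleftrightarrow> (\<exists>w. pr x w \<in> {q. \<forall>y. res y (sn q 0) = res (fs q) (sn q 0) \<longrightarrow> y \<in> A})"
  proof
    assume "x \<in> A"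
    from open_contains_res[OF assms this]
    obtain n where "\<And>y. res y n = res x n \<Longrightarrow> y \<in> A" by blast
    then show "\<exists>w. pr x w \<in> {q. \<forall>y. res y (sn q 0) = res (fs q) (sn q 0) \<longrightarrow> y \<in> A}"
      by (intro exI[of _ "\<lambda>_. n"]) simp
  qed auto
qed

text \<open>A witness begins with the index of a set that contains the point and continues with a
  witness for that set.\<close>

lemma suslin_Union:
  assumes "\<And>i::nat. suslin (A i)"
  shows "suslin (\<Union>i. A i)"
proof -
  obtain C where C: "\<And>i. closed (C i)" and A: "\<And>i x. x \<in> A i \<longleftrightarrow> (\<exists>w. pr x w \<in> C i)"
    using assms unfolding suslin_def by metis
  \<comment> \<open>Reading the index through an implication under a universal quantifier makes
    \<open>?D\<close> an intersection of closed sets.\<close>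
  let ?D = "{q. \<forall>i. sn q 0 = i \<longrightarrow> pr (fs q) (\<lambda>n. sn q (Suc n)) \<in> C i}"
  have sn: "loc_const (\<lambda>q. sn q i)" for i using continuous_sn by (simp add: continuous_iff_loc_const)
  have "continuous_on UNIV (\<lambda>q. pr (fs q) (\<lambda>n. sn q (Suc n)))"
    by (intro continuous_pr continuous_fs) (simp add: continuous_iff_loc_const sn)
  then have "closed ?D"
    by (intro closed_Collect_all closed_Collect_imp open_loc_const closed_vimage_UNIV C
        loc_const_comp[OF sn])
  moreover have "x \<in> (\<Union>i. A i) \<longleftrightarrow> (\<exists>w. pr x w \<in> ?D)" for x
  proof
    assume "x \<in> (\<Union>i. A i)"
    then obtain i w where "pr x w \<in> C i" using A by blast
    then show "\<exists>w. pr x w \<in> ?D" by (intro exI[of _ "case_nat i w"]) simp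
  qed (use A in auto)
  ultimately show ?thesis unfolding suslin_def by blast
qed

lemma suslin_Inter:
  assumes "\<And>i::nat. suslin (A i)"
  shows "suslin (\<Inter>i. A i)"
proof -
  obtain C where C: "\<And>i. closed (C i)" and A: "\<And>i x. x \<in> A i \<longleftrightarrow> (\<exists>w. pr x w \<in> C i)"
    using assms unfolding suslin_def by metis
  let ?D = "{q. \<forall>i. pr (fs q) (col (sn q) i) \<in> C i}"
  have "continuous_on UNIV (\<lambda>q. col (sn q) i)" for i
    using continuous_on_compose2[OF continuous_col continuous_sn] by simp
  then have "closed ?D"
    by (intro closed_Collect_all closed_vimage_UNIV C continuous_pr continuous_fs)
  moreover have "x \<in> (\<Inter>i. A i) \<longleftrightarrow> (\<exists>w. pr x w \<in> ?D)" for x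
  proof
    assume "x \<in> (\<Inter>i. A i)"
    then obtain w where "\<And>i. pr x (w i) \<in> C i" using A by (metis INT_E UNIV_I)
    then show "\<exists>w. pr x w \<in> ?D" by (intro exI[of _ "cols w"]) simp
  qed (use A in auto)
  ultimately show ?thesis unfolding suslin_def by blast
qed

text \<open>Projections of closed sets are not closed under complements, so the induction carries
  each set together with its complement.\<close>

lemma borel_suslin:
  assumes "A \<in> sets (borel :: baire measure)"
  shows "suslin A"
proof -
  have "A \<in> sigma_sets UNIV {S :: baire set. open S}"
    using assms by (simp add: borel_def)
  then have "suslin A \<and> suslin (- A)"
  proof (induction rule: sigma_sets.induct)
    case (Basic a) then show ?case by (auto intro: suslin_open suslin_closed)
  next
    case Empty then show ?case by (auto intro: suslin_closed)
  next
    case (Compl a) then show ?case by (simp add: Compl_eq_Diff_UNIV[symmetric])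
  next
    case (Union a)
    then show ?case by (auto intro: suslin_Union suslin_Inter)
  qed
  then show ?thesis by blast
qed

text \<open>The form suited to separation: the image can be split along the nodes of Baire space.
  Images of closed sets, rather than of the whole space, include the empty set.\<close>

definition analytic :: "baire set \<Rightarrow> bool" where
  "analytic A \<longleftrightarrow> (\<exists>(C :: baire set) f. closed C \<and> continuous_on UNIV f \<and> A = f ` C)"

lemma analytic_image_borel:
  assumes "A \<in> sets borel" "continuous_on UNIV (f :: baire \<Rightarrow> baire)"
  shows "analytic (f ` A)"
proof -
  obtain C where C: "closed C" "\<And>x. x \<in> A \<longleftrightarrow> (\<exists>w. pr x w \<in> C)"
    using borel_suslin[OF assms(1)] unfolding suslin_def by blast
  have "continuous_on UNIV (\<lambda>q. f (fs q))"
    using continuous_on_compose2[OF assms(2) continuous_fs] by simp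
  moreover have "A = fs ` C" using C(2) by (auto simp: image_iff) (metis fs_pr pr_fs_sn)+
  then have "f ` A = (\<lambda>q. f (fs q)) ` C" by auto
  ultimately show ?thesis unfolding analytic_def using C(1) by blast
qed

section \<open>Borel separation of analytic sets\<close>

definition borel_separable :: "baire set \<Rightarrow> baire set \<Rightarrow> bool" where
  "borel_separable A B \<longleftrightarrow> (\<exists>D \<in> sets borel. A \<subseteq> D \<and> B \<inter> D = {})"

lemma borel_separable_Union:
  assumes "\<And>(i::nat) (j::nat). borel_separable (A i) (B j)"
  shows "borel_separable (\<Union>i. A i) (\<Union>j. B j)"
proof -
  obtain D where D: "\<And>i j. D i j \<in> sets borel" "\<And>i j. A i \<subseteq> D i j" "\<And>i j. B j \<inter> D i j = {}"
    using assms unfolding borel_separable_def by metis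
  have "(\<Union>i. \<Inter>j. D i j) \<in> sets borel" using D(1) by (intro sets.countable_UN sets.countable_INT) auto
  moreover have "(\<Union>i. A i) \<subseteq> (\<Union>i. \<Inter>j. D i j)" using D(2) by blast
  moreover have "(\<Union>j. B j) \<inter> (\<Union>i. \<Inter>j. D i j) = {}" using D(3) by blast
  ultimately show ?thesis unfolding borel_separable_def by blast
qed

text \<open>If the images of two cones cannot be separated, neither can those of some pair of cones
  one level down; this leads to branches \<open>p\<close> and \<open>q\<close>. As
  \<open>f p\<close> and \<open>g q\<close> differ, continuity lets a basic open set around
  \<open>f p\<close> separate the images of small cones, a contradiction.\<close>

lemma lusin_separation:
  assumes "analytic A" "analytic B" "A \<inter> B = {}"
  shows "borel_separable A B"
proof (rule ccontr)
  assume not_sep: "\<not> borel_separable A B"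
  obtain C f where C: "closed (C :: baire set)" "continuous_on UNIV f" "A = f ` C"
    using assms unfolding analytic_def by blast
  obtain D g where D: "closed (D :: baire set)" "continuous_on UNIV g" "B = g ` D"
    using assms unfolding analytic_def by blast
  define a where "a s = f ` {p \<in> C. res p (length s) = s}" for s
  define b where "b s = g ` {p \<in> D. res p (length s) = s}" for s
  have "a s = (\<Union>i. a (i # s))" "b s = (\<Union>i. b (i # s))" for s
    unfolding a_def b_def by auto
  then have step: "\<exists>i j. \<not> borel_separable (a (i # s)) (b (j # t))" if "\<not> borel_separable (a s) (b t)" for s t
    using borel_separable_Union[of "\<lambda>i. a (i # s)" "\<lambda>j. b (j # t)"] that by metis
  have "\<exists>u. \<forall>n. (\<not> borel_separable (a (fst (u n))) (b (snd (u n))) \<and> length (fst (u n)) = n \<and> length (snd (u n)) = n)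
      \<and> (tl (fst (u (Suc n))) = fst (u n) \<and> tl (snd (u (Suc n))) = snd (u n))"
  proof (rule dependent_nat_choice)
    show "\<exists>x. \<not> borel_separable (a (fst x)) (b (snd x)) \<and> length (fst x) = 0 \<and> length (snd x) = 0"
      using not_sep C(3) D(3) by (intro exI[of _ "([], [])"]) (simp add: a_def b_def)
  next
    fix x n assume x: "\<not> borel_separable (a (fst x)) (b (snd x)) \<and> length (fst x) = n \<and> length (snd x) = n"
    then obtain i j where "\<not> borel_separable (a (i # fst x)) (b (j # snd x))" using step by blast
    then show "\<exists>y. (\<not> borel_separable (a (fst y)) (b (snd y)) \<and> length (fst y) = Suc n \<and> length (snd y) = Suc n)
      \<and> (tl (fst y) = fst x \<and> tl (snd y) = snd x)"
      using x by (intro exI[of _ "(i # fst x, j # snd x)"]) simp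
  qed
  then obtain u where u: "\<And>n. \<not> borel_separable (a (fst (u n))) (b (snd (u n)))"
    "\<And>n. length (fst (u n)) = n" "\<And>n. length (snd (u n)) = n"
    "\<And>n. tl (fst (u (Suc n))) = fst (u n)" "\<And>n. tl (snd (u (Suc n))) = snd (u n)" by metis
  obtain p where p: "\<And>n. res p n = fst (u n)" using res_coherent[of "\<lambda>n. fst (u n)"] u by blast
  obtain q where q: "\<And>n. res q n = snd (u n)" using res_coherent[of "\<lambda>n. snd (u n)"] u by blast
  have ns: "\<not> borel_separable (a (res p n)) (b (res q n))" for n using u(1) p q by simp
  \<comment> \<open>The empty set is separable from every set, so the cones along both branches meet
    \<open>C\<close> and \<open>D\<close>.\<close>
  have "a (res p n) \<noteq> {}" "b (res q n) \<noteq> {}" for n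
  proof -
    show "a (res p n) \<noteq> {}" using ns[of n] unfolding borel_separable_def by force
    show "b (res q n) \<noteq> {}" using ns[of n] unfolding borel_separable_def by (force intro: bexI[of _ UNIV])
  qed
  then have "\<exists>y\<in>C. res y n = res p n" "\<exists>y\<in>D. res y n = res q n" for n
    unfolding a_def b_def by auto
  then have "p \<in> C" "q \<in> D" using closed_mem_res C(1) D(1) by blast+
  then have "f p \<noteq> g q" using assms(3) C(3) D(3) by blast
  then obtain m where m: "res (f p) m \<noteq> res (g q) m" using res_eqI by blast
  obtain n1 where n1: "\<And>y. res y n1 = res p n1 \<Longrightarrow> res (f y) m = res (f p) m"
    using continuous_res[OF C(2), of p m] by blast
  obtain n2 where n2: "\<And>y. res y n2 = res q n2 \<Longrightarrow> res (g y) m = res (g q) m"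
    using continuous_res[OF D(2), of q m] by blast
  define n where "n = max n1 n2"
  have "res (f y) m = res (f p) m" if "res y n = res p n" for y
    using res_eq_mono[OF that, of n1] n1[of y] by (simp add: n_def)
  then have "a (res p n) \<subseteq> {x. res x m = res (f p) m}"
    unfolding a_def length_res by blast
  moreover have "res (g y) m \<noteq> res (f p) m" if "res y n = res q n" for y
    using res_eq_mono[OF that, of n2] n2[of y] m by (simp add: n_def)
  then have "b (res q n) \<inter> {x. res x m = res (f p) m} = {}"
    unfolding b_def length_res by blast
  moreover have "{x::baire. res x m = res (f p) m} \<in> sets borel" by (intro borel_open open_res)
  ultimately show False using ns[of n] unfolding borel_separable_def by blast
qed

text \<open>Countably many separations of pairs are intersected. Removing \<open>D j i\<close> from
  \<open>D i j\<close> is what makes \<open>B i\<close> and \<open>B j\<close> disjoint.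
  \<open>R\<close> will relate distinct nodes of equal length.\<close>

lemma lusin_separation_family:
  fixes A :: "'i::countable \<Rightarrow> baire set"
  assumes "\<And>i. analytic (A i)" "\<And>i j. R i j \<Longrightarrow> A i \<inter> A j = {}" "\<And>i j. R i j \<Longrightarrow> R j i"
  obtains B where "\<And>i. B i \<in> sets borel" "\<And>i. A i \<subseteq> B i" "\<And>i j. R i j \<Longrightarrow> B i \<inter> B j = {}"
proof -
  have "\<exists>D. D \<in> sets borel \<and> (R i j \<longrightarrow> A i \<subseteq> D \<and> A j \<inter> D = {})" for i j
    using lusin_separation[of "A i" "A j"] assms unfolding borel_separable_def
    by (cases "R i j") blast+
  then obtain D where D: "\<And>i j. D i j \<in> sets borel" "\<And>i j. R i j \<Longrightarrow> A i \<subseteq> D i j"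
    "\<And>i j. R i j \<Longrightarrow> A j \<inter> D i j = {}" by metis
  define B where "B i = (\<Inter>j. if R i j then D i j \<inter> - D j i else UNIV)" for i
  show ?thesis
  proof
    show "B i \<in> sets borel" for i unfolding B_def using D(1) by (intro sets.countable_INT'') auto
    show "A i \<subseteq> B i" for i unfolding B_def using D(2,3) assms(3) by fastforce
    show "B i \<inter> B j = {}" if "R i j" for i j
      using that assms(3)[OF that] unfolding B_def by (auto split: if_splits)
  qed
qed

text \<open>\<open>x\<close> codes the set of nodes at whose codes it is 0. This set need not be
  closed under initial segments; a branch must have all its nonempty segments in it.\<close>

definition ill_founded :: "baire set" where
  "ill_founded = {x. \<exists>w. \<forall>n. x (list_encode (res w (Suc n))) = 0}"

lemma course_of_values: "\<exists>x. \<forall>k. x k = G k (res x k)"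
proof -
  define u where "u = rec_nat [] (\<lambda>n s. G n s # s)"
  have u: "u 0 = []" "\<And>n. u (Suc n) = G n (u n) # u n" by (auto simp: u_def)
  have "length (u n) = n" for n by (induction n) (auto simp: u)
  then obtain x where "\<And>n. res x n = u n" using res_coherent[of u] u(2) by auto
  then show ?thesis using u(2) by (intro exI[of _ x]) (metis list.inject res.simps(2))
qed

lemma drop_res: "m \<le> k \<Longrightarrow> drop (k - m) (res x k) = res x m"
  by (induction k) (auto simp: le_Suc_eq Suc_diff_le)

lemma length_le_list_encode: "length s \<le> list_encode s"
proof (induction s)
  case (Cons a s)
  then show ?case using le_prod_encode_2[of "list_encode s" a] by simp
qed simp

text \<open>The tree of a closed set \<open>C\<close>, with \<open>l\<close> a segment of the
  parameter and \<open>s\<close> a node of the section. Only the first \<open>length s\<close>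
  values of the parameter matter for \<open>s\<close>.\<close>

definition section_tree :: "baire set \<Rightarrow> nat list \<Rightarrow> nat list \<Rightarrow> bool" where
  "section_tree C l s \<longleftrightarrow> (\<exists>q\<in>C. res (fs q) (length s) = l \<and> res (sn q) (length s) = s)"

lemma section_tree_mem: "pr x w \<in> C \<Longrightarrow> section_tree C (res x n) (res w n)"
  unfolding section_tree_def by (rule bexI[of _ "pr x w"]) simp_all

text \<open>A closed set is the body of its tree. The empty node is left out to match
  \<open>ill_founded\<close> and \<open>branchless\<close>.\<close>

lemma section_tree_branch:
  assumes "closed C" and Q: "\<And>n. section_tree C (res x (Suc n)) (res w (Suc n))"
  shows "pr x w \<in> C"
proof (rule closed_mem_res[OF assms(1)])
  fix n
  obtain q where "q \<in> C" "res (fs q) (Suc n) = res x (Suc n)" "res (sn q) (Suc n) = res w (Suc n)"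
    using Q[of n] unfolding section_tree_def length_res by blast
  then have "q \<in> C" "\<And>i. i < n \<Longrightarrow> fs q i = x i \<and> sn q i = w i" by (simp_all add: res_eq_iff)
  moreover have "q i = prod_encode (fs q i, sn q i)" for i by (simp add: fs_def sn_def)
  ultimately show "\<exists>y\<in>C. res y n = res (pr x w) n"
    by (intro bexI[of _ q]) (auto simp: res_eq_iff pr_def)
qed

lemma section_tree_Cons:
  assumes "section_tree C (res x (Suc (length s))) (a # s)"
  shows "section_tree C (res x (length s)) s"
  using assms unfolding section_tree_def by auto

text \<open>Were the complement projected from a closed set \<open>C\<close>, then there would be an \<open>x\<close> that is, as a tree,
  its own section tree of \<open>C\<close>: membership of a node of length \<open>n\<close> depends on \<open>x\<close> below \<open>n\<close> only, and
  \<open>list_encode\<close> gives that node a code at least \<open>n\<close>.\<close>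

lemma ill_founded_not_borel: "ill_founded \<notin> sets borel"
proof
  assume "ill_founded \<in> sets borel"
  then have "- ill_founded \<in> sets borel" by auto
  then obtain C where C: "closed C" "\<And>x. x \<notin> ill_founded \<longleftrightarrow> (\<exists>w. pr x w \<in> C)"
    using borel_suslin unfolding suslin_def by (metis ComplI ComplD)
  let ?Q = "section_tree C"
  \<comment> \<open>\<open>drop\<close> cuts the reversed segment of length \<open>k\<close> down to
    the length of the node coded by \<open>k\<close>.\<close>
  obtain x where x: "\<And>k. x k = (if ?Q (drop (k - length (list_decode k)) (res x k)) (list_decode k) then 0 else (1::nat))"
    using course_of_values[of "\<lambda>k l. if ?Q (drop (k - length (list_decode k)) l) (list_decode k) then 0 else 1"] by blast
  have "x (list_encode s) = 0 \<longleftrightarrow> ?Q (res x (length s)) s" for s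
    by (subst x) (simp add: drop_res length_le_list_encode)
  then have "x \<in> ill_founded \<longleftrightarrow> (\<exists>w. \<forall>n. ?Q (res x (Suc n)) (res w (Suc n)))"
    unfolding ill_founded_def by (simp only: mem_Collect_eq length_res)
  also have "\<dots> \<longleftrightarrow> (\<exists>w. pr x w \<in> C)"
  proof (intro ex_cong1 iffI)
    fix w assume "\<forall>n. ?Q (res x (Suc n)) (res w (Suc n))"
    then show "pr x w \<in> C" by (intro section_tree_branch[OF C(1)]) blast
  qed (intro allI section_tree_mem)
  finally show False using C(2) by blast
qed

section \<open>Equivalence relations from trees\<close>

lemma closed_pairI_res:
  assumes "\<And>x y. (\<And>n. \<exists>x' y'. (x', y') \<in> C \<and> res x' n = res x n \<and> res y' n = res y n) \<Longrightarrow> (x, y) \<in> (C :: (baire \<times> baire) set)"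
  shows "closed C"
  unfolding closed_def
proof (subst open_subopen, clarify)
  fix x y :: baire
  assume "(x, y) \<notin> C"
  then obtain n where n: "\<And>x' y'. res x' n = res x n \<Longrightarrow> res y' n = res y n \<Longrightarrow> (x', y') \<notin> C"
    using assms by metis
  have "open ({x' :: baire. res x' n = res x n} \<times> {y' :: baire. res y' n = res y n})"
    by (intro open_Times open_res)
  then show "\<exists>T. open T \<and> (x, y) \<in> T \<and> T \<subseteq> - C"
    by (intro exI[of _ "{x'. res x' n = res x n} \<times> {y'. res y' n = res y n}"]) (use n in auto)
qed

lemma borel_singleton_baire: "{x :: baire} \<in> sets borel"
proof -
  have "{x} = {y. \<forall>n. res y n = res x n}" by (auto intro: res_eqI)
  also have "closed \<dots>" by (intro closed_Collect_all closed_loc_const loc_const_res)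
  finally show ?thesis by (rule borel_closed)
qed

text \<open>Shifting the values by one makes room for the value 0. The eventually zero sequences added to the
  body of \<open>K\<close> make every node of the tree extendible, so that hitting an open set is a countable
  condition on \<open>K\<close>.\<close>

definition junk_tree :: "(nat list \<Rightarrow> bool) \<Rightarrow> nat list \<Rightarrow> bool" where
  "junk_tree K s \<longleftrightarrow> (\<exists>k t. s = replicate k 0 @ map Suc t \<and> K t)"

definition junk_set :: "(nat list \<Rightarrow> bool) \<Rightarrow> baire set" where
  "junk_set K = {p. \<forall>n. junk_tree K (res p n)}"

text \<open>The first projection on shifted values. Only 0 is sent to 0, so the zeros of equivalent
  points start at the same place.\<close>

definition shift_fst :: "nat \<Rightarrow> nat" where
  "shift_fst a = (case a of 0 \<Rightarrow> 0 | Suc b \<Rightarrow> Suc (fst (prod_decode b)))"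

text \<open>Inside \<open>junk_set K\<close> the classes are the fibres of the first coordinate;
  every other point is alone in its class, so that the relation lives on all of Baire space.\<close>

definition fibre_rel :: "(nat list \<Rightarrow> bool) \<Rightarrow> (baire \<times> baire) set" where
  "fibre_rel K = {(p, q). p = q \<or>
     p \<in> junk_set K \<and> q \<in> junk_set K \<and> (\<lambda>n. shift_fst (p n)) = (\<lambda>n. shift_fst (q n))}"

section \<open>Trees with added zeros\<close>

definition hereditary :: "(nat list \<Rightarrow> bool) \<Rightarrow> bool" where
  "hereditary K \<longleftrightarrow> (\<forall>a s. K (a # s) \<longrightarrow> K s)"

lemma hereditary_drop: "hereditary K \<Longrightarrow> K s \<Longrightarrow> K (drop k s)"
proof (induction k)
  case (Suc k)
  have "drop k s = [] \<or> (\<exists>a. drop k s = a # drop (Suc k) s)"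
    by (cases "k < length s") (auto simp: Cons_nth_drop_Suc[symmetric])
  then show ?case
    using Suc unfolding hereditary_def by (metis drop_Suc drop_Nil tl_drop list.sel(2))
qed simp

lemma hereditary_res_mono:
  assumes "hereditary K" "K (res x n)" "m \<le> n"
  shows "K (res x m)"
  using hereditary_drop[OF assms(1,2), of "n - m"] drop_res[OF assms(3), of x] by simp

text \<open>Segments are reversed, so the block of zeros in \<open>junk_tree\<close> is the final
  part of the node; hence nothing but zeros can follow a zero.\<close>

lemma junk_tree_Cons:
  assumes "hereditary K" "junk_tree K (a # s)"
  shows "junk_tree K s \<and> (s \<noteq> [] \<longrightarrow> hd s = 0 \<longrightarrow> a = 0)"
proof -
  obtain k t where kt: "a # s = replicate k 0 @ map Suc t" "K t"
    using assms(2) unfolding junk_tree_def by blast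
  show ?thesis
  proof (cases k)
    case 0
    then obtain b u where "t = b # u" "a = Suc b" "s = map Suc u" using kt(1) by (cases t) auto
    moreover have "K u" using assms(1) kt(2) \<open>t = b # u\<close> unfolding hereditary_def by blast
    ultimately show ?thesis unfolding junk_tree_def
      by (auto intro!: exI[of _ 0] exI[of _ u] simp: hd_map)
  next
    case (Suc k')
    then show ?thesis using kt unfolding junk_tree_def by auto
  qed
qed

lemma junk_tree_zero: "junk_tree K s \<Longrightarrow> junk_tree K (0 # s)"
  unfolding junk_tree_def by (metis append_Cons replicate_Suc)

lemma junk_tree_map_Suc [simp]: "junk_tree K (map Suc t) \<longleftrightarrow> K t"
proof
  assume "junk_tree K (map Suc t)"
  then obtain k u where ku: "map Suc t = replicate k 0 @ map Suc u" "K u"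
    unfolding junk_tree_def by blast
  then have "k = 0" by (cases k; cases t) auto
  then show "K t" using ku by (simp add: inj_map_eq_map)
next
  assume "K t" then show "junk_tree K (map Suc t)"
    unfolding junk_tree_def by (intro exI[of _ 0]) auto
qed

lemma hereditary_junk_tree: "hereditary K \<Longrightarrow> hereditary (junk_tree K)"
  using junk_tree_Cons unfolding hereditary_def by blast

lemma junk_setI:
  assumes "hereditary K" "\<And>n. \<exists>m\<ge>n. junk_tree K (res p m)"
  shows "p \<in> junk_set K"
  unfolding junk_set_def using hereditary_res_mono[OF hereditary_junk_tree] assms by blast

lemma junk_set_Suc: "(\<lambda>n. Suc (p n)) \<in> junk_set K \<longleftrightarrow> (\<forall>n. K (res p n))"
  unfolding junk_set_def by (simp add: res_map[of Suc p])

lemma junk_set_zeros: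
  assumes "hereditary K" "p \<in> junk_set K" "p n = 0" "n \<le> m"
  shows "p m = 0"
  using assms(4)
proof (induction m rule: dec_induct)
  case (step m)
  have "junk_tree K (p (Suc m) # p m # res p m)"
    using assms(2) unfolding junk_set_def by (metis mem_Collect_eq res.simps(2))
  then show ?case using junk_tree_Cons[OF assms(1)] step by fastforce
qed (rule assms(3))

lemma countable_eventually_zero: "countable {p :: baire. \<exists>n. \<forall>m\<ge>n. p m = 0}"
proof -
  have "{p :: baire. \<exists>n. \<forall>m\<ge>n. p m = 0} \<subseteq> range (\<lambda>s i. if i < length s then s ! i else 0)"
  proof clarify
    fix p :: baire and n assume "\<forall>m\<ge>n. p m = 0"
    then have "p = (\<lambda>i. if i < length (map p [0..<n]) then map p [0..<n] ! i else 0)"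
      by (auto simp: fun_eq_iff)
    then show "p \<in> range (\<lambda>s i. if i < length s then s ! i else 0)" by blast
  qed
  then show ?thesis by (rule countable_subset) simp
qed

lemma closed_junk_set: "closed (junk_set K)"
  unfolding junk_set_def by (intro closed_Collect_all closed_loc_const loc_const_res)

text \<open>Pairs close to two distinct limit points are distinct as well, so they lie in the junk
  set and have equal first coordinates. These are conditions on initial segments and pass to the
  limit.\<close>

lemma closed_fibre_rel:
  assumes K: "hereditary K"
  shows "closed (fibre_rel K)"
proof (rule closed_pairI_res)
  fix p q :: baire
  assume lim: "\<And>n. \<exists>p' q'. (p', q') \<in> fibre_rel K \<and> res p' n = res p n \<and> res q' n = res q n"
  show "(p, q) \<in> fibre_rel K"
  proof (cases "p = q")
    case False
    then obtain m where m: "res p m \<noteq> res q m" using res_eqI by blast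
    have n: "junk_tree K (res p n) \<and> junk_tree K (res q n) \<and> map shift_fst (res p n) = map shift_fst (res q n)"
      if "n \<ge> m" for n
    proof -
      obtain p' q' where pq: "(p', q') \<in> fibre_rel K" "res p' n = res p n" "res q' n = res q n"
        using lim by blast
      have "p' \<noteq> q'" using pq(2,3) m res_eq_mono[OF _ that, of p q] by metis
      then have "p' \<in> junk_set K" "q' \<in> junk_set K" "(\<lambda>n. shift_fst (p' n)) = (\<lambda>n. shift_fst (q' n))"
        using pq(1) unfolding fibre_rel_def by auto
      then show ?thesis using pq(2,3) unfolding junk_set_def by (metis mem_Collect_eq res_map)
    qed
    have "p \<in> junk_set K" "q \<in> junk_set K"
      using n by (metis junk_setI[OF K] linear)+
    moreover have "(\<lambda>n. shift_fst (p n)) = (\<lambda>n. shift_fst (q n))"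
    proof (rule res_eqI)
      fix n
      have "res (\<lambda>n. shift_fst (p n)) (max m n) = res (\<lambda>n. shift_fst (q n)) (max m n)"
        using n[of "max m n"] by (simp add: res_map)
      then show "res (\<lambda>n. shift_fst (p n)) n = res (\<lambda>n. shift_fst (q n)) n"
        by (rule res_eq_mono) simp
    qed
    ultimately show ?thesis by (simp add: fibre_rel_def)
  qed (simp add: fibre_rel_def)
qed

lemma equiv_fibre_rel: "equiv UNIV (fibre_rel K)"
  by (rule equivI) (auto simp: fibre_rel_def refl_on_def sym_def trans_def)

text \<open>Two nodes with equal first coordinates extend by zeros to two related points, so no
  infinite branch of \<open>K\<close> has to be found.\<close>

lemma fibre_rel_Int_open:
  assumes K: "hereditary K" and U: "open U"
  shows "fibre_rel K \<inter> U \<noteq> {} \<longleftrightarrow>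
    (\<exists>s t. length s = length t \<and> (\<forall>p q. res p (length s) = s \<longrightarrow> res q (length s) = t \<longrightarrow> (p, q) \<in> U) \<and>
       (s = t \<or> junk_tree K s \<and> junk_tree K t \<and> map shift_fst s = map shift_fst t))"
    (is "_ \<longleftrightarrow> ?R")
proof
  assume "fibre_rel K \<inter> U \<noteq> {}"
  then obtain p q where pq: "(p, q) \<in> fibre_rel K" "(p, q) \<in> U" by auto
  obtain n where n: "\<And>p' q'. res p' n = res p n \<Longrightarrow> res q' n = res q n \<Longrightarrow> (p', q') \<in> U"
    using open_contains_res2[OF U pq(2)] by blast
  have "p = q \<or> junk_tree K (res p n) \<and> junk_tree K (res q n) \<and> map shift_fst (res p n) = map shift_fst (res q n)"
    using pq(1) unfolding fibre_rel_def junk_set_def by (auto simp flip: res_map)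
  then show ?R using n by (intro exI[of _ "res p n"] exI[of _ "res q n"]) auto
next
  assume ?R
  then obtain s t where st: "length s = length t"
    "\<And>p q. res p (length s) = s \<Longrightarrow> res q (length s) = t \<Longrightarrow> (p, q) \<in> U"
    "s = t \<or> junk_tree K s \<and> junk_tree K t \<and> map shift_fst s = map shift_fst t" by blast
  obtain p where p: "res p (length s) = s" "\<forall>i\<ge>length s. p i = 0" using res_extend[of s 0] by blast
  obtain q where q: "res q (length t) = t" "\<forall>i\<ge>length t. q i = 0" using res_extend[of t 0] by blast
  have junk: "r \<in> junk_set K" if "junk_tree K u" "res r (length u) = u" "\<forall>i\<ge>length u. r i = 0" for r u
  proof -
    have "junk_tree K (res r (length u + n))" for n
      using that by (induction n) (auto intro: junk_tree_zero)
    then show ?thesis by (intro junk_setI[OF K]) (metis le_add2)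
  qed
  show "fibre_rel K \<inter> U \<noteq> {}"
  proof (cases "s = t")
    case True
    then have "(p, p) \<in> fibre_rel K \<inter> U" using st(2) p by (auto simp: fibre_rel_def)
    then show ?thesis by blast
  next
    case False
    then have t: "junk_tree K s" "junk_tree K t" "map shift_fst s = map shift_fst t" using st(3) by auto
    have "shift_fst (p n) = shift_fst (q n)" for n
    proof (cases "n < length s")
      case True
      have "res (\<lambda>n. shift_fst (p n)) (length s) = res (\<lambda>n. shift_fst (q n)) (length s)"
        using t(3) p(1) q(1) st(1) by (simp add: res_map)
      then show ?thesis using True by (simp add: res_eq_iff)
    qed (use p q st(1) in auto)
    then have "(p, q) \<in> fibre_rel K \<inter> U"
      using junk t p q st by (auto simp: fibre_rel_def)
    then show ?thesis by blast
  qed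
qed

lemma measurable_fibre_rel:
  assumes K: "\<And>c. hereditary (K c)" and [measurable]: "\<And>s. Measurable.pred M (\<lambda>c. K c s)"
  shows "(\<lambda>c. fibre_rel (K c)) \<in> M \<rightarrow>\<^sub>M effros"
  unfolding effros_def
proof (rule measurable_measure_of)
  have [measurable]: "Measurable.pred M (\<lambda>c. junk_tree (K c) s)" for s
    unfolding junk_tree_def by measurable
  fix X assume "X \<in> {{F :: (baire \<times> baire) set. closed F \<and> F \<inter> U \<noteq> {}} |U. open U}"
  then obtain U where U: "X = {F. closed F \<and> F \<inter> U \<noteq> {}}" "open U" by blast
  have "(\<lambda>c. fibre_rel (K c)) -` X \<inter> space M = {c \<in> space M. fibre_rel (K c) \<inter> U \<noteq> {}}"
    using U closed_fibre_rel[OF K] by auto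
  also have "\<dots> = {c \<in> space M.
    (\<exists>s t. length s = length t \<and> (\<forall>p q. res p (length s) = s \<longrightarrow> res q (length s) = t \<longrightarrow> (p, q) \<in> U) \<and>
       (s = t \<or> junk_tree (K c) s \<and> junk_tree (K c) t \<and> map shift_fst s = map shift_fst t))}"
    unfolding fibre_rel_Int_open[OF K U(2)] ..
  also have "\<dots> \<in> sets M" by measurable
  finally show "(\<lambda>c. fibre_rel (K c)) -` X \<inter> space M \<in> sets M" .
qed (auto simp: closed_fibre_rel[OF K])

text \<open>\<sigma> chooses a point of the body of \<open>K\<close> over each element of the
  projection, hence one point per class. Points containing a 0 are treated separately.\<close>

lemma selector_if_uniformization:
  assumes K: "hereditary K" and [measurable]: "\<sigma> \<in> borel \<rightarrow>\<^sub>M borel"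
    and \<sigma>: "\<And>p. \<forall>n. K (res p n) \<Longrightarrow> (\<forall>n. K (res (\<sigma> (fs p)) n)) \<and> fs (\<sigma> (fs p)) = fs p"
  shows "\<exists>s. borel_selector (fibre_rel K) s"
proof -
  define J where "J = {p \<in> junk_set K. \<exists>n. p n = 0}"
  define f where "f p = (if p \<in> junk_set K then (\<lambda>n. Suc (\<sigma> (fs (\<lambda>n. p n - 1)) n)) else p)" for p
  \<comment> \<open>On the countable set \<open>J\<close> any choice is Borel, and
    \<open>SOME\<close> is applied to the class, so it is constant on classes. In \<open>f\<close>,
    the term \<open>p n - 1\<close> undoes the shift.\<close>
  define s where "s p = (if p \<in> J then SOME q. (p, q) \<in> fibre_rel K else f p)" for p
  have [measurable]: "junk_set K \<in> sets borel" using closed_junk_set by (rule borel_closed)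
  have "(\<lambda>p. \<lambda>n. p n - 1) \<in> borel \<rightarrow>\<^sub>M (borel :: baire measure)"
    unfolding measurable_baire_iff by measurable
  note [measurable] = this
  have "(\<lambda>p. \<sigma> (fs (\<lambda>n. p n - 1))) \<in> borel \<rightarrow>\<^sub>M borel" by measurable
  note coord = this[unfolded measurable_baire_iff, rule_format]
  have "(\<lambda>p n. Suc (\<sigma> (fs (\<lambda>n. p n - 1)) n)) \<in> borel \<rightarrow>\<^sub>M (borel :: baire measure)"
    unfolding measurable_baire_iff by (intro allI measurable_compose[OF coord measurable_count_space])
  note [measurable] = this
  have f: "f \<in> borel \<rightarrow>\<^sub>M borel" unfolding f_def by measurable
  have "countable J"
    by (rule countable_subset[OF _ countable_eventually_zero])
      (use junk_set_zeros[OF K] in \<open>auto simp: J_def\<close>)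
  then have s: "s \<in> borel \<rightarrow>\<^sub>M borel"
    by (rule measurable_discrete_difference[OF f])
      (auto simp: s_def borel_singleton_baire)
  have Suc_pred: "p = (\<lambda>n. Suc (p n - 1))" if "p \<in> junk_set K - J" for p
    using that by (auto simp: J_def fun_eq_iff)
  have shift_Suc: "(\<lambda>n. shift_fst (Suc (r n))) = (\<lambda>n. Suc (fs r n))" for r
    by (simp add: shift_fst_def fs_def)
  have in_rel: "(s p, p) \<in> fibre_rel K" for p
  proof (cases "p \<in> J")
    case True
    have "\<exists>q. (p, q) \<in> fibre_rel K" by (intro exI[of _ p]) (simp add: fibre_rel_def)
    then have "(p, SOME q. (p, q) \<in> fibre_rel K) \<in> fibre_rel K" by (rule someI_ex)
    then have "(p, s p) \<in> fibre_rel K" using True by (simp add: s_def)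
    then show ?thesis by (auto simp: fibre_rel_def)
  next
    case False
    show ?thesis
    proof (cases "p \<in> junk_set K")
      case True
      define r where "r = (\<lambda>n. p n - 1)"
      have p: "p = (\<lambda>n. Suc (r n))" using Suc_pred True False by (auto simp: r_def)
      then have r: "\<forall>n. K (res r n)" using True by (simp add: junk_set_Suc)
      have "s p = (\<lambda>n. Suc (\<sigma> (fs r) n))" using True False by (simp add: s_def f_def r_def)
      then show ?thesis
        using \<sigma>[OF r] True unfolding fibre_rel_def p by (simp add: junk_set_Suc shift_Suc)
    qed (use False in \<open>simp add: s_def f_def fibre_rel_def\<close>)
  qed
  have "s p = s q" if pq: "(p, q) \<in> fibre_rel K" for p q
  proof (cases "p = q")
    case False
    then have j: "p \<in> junk_set K" "q \<in> junk_set K" "(\<lambda>n. shift_fst (p n)) = (\<lambda>n. shift_fst (q n))"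
      using pq by (auto simp: fibre_rel_def)
    \<comment> \<open>Equivalent points have their zeros at the same places, so \<open>J\<close> is
      a union of classes.\<close>
    have zero: "p n = 0 \<longleftrightarrow> q n = 0" for n
      using fun_cong[OF j(3), of n] by (auto simp: shift_fst_def split: nat.splits)
    show ?thesis
    proof (cases "p \<in> J")
      case True
      then have "q \<in> J" using j zero by (auto simp: J_def)
      moreover have "(p, r) \<in> fibre_rel K \<longleftrightarrow> (q, r) \<in> fibre_rel K" for r
        using j by (auto simp: fibre_rel_def)
      ultimately show ?thesis using True by (simp add: s_def)
    next
      case False
      then have q: "q \<notin> J" using j zero by (auto simp: J_def)
      have "(\<lambda>n. Suc (fs (\<lambda>n. p n - 1) n)) = (\<lambda>n. Suc (fs (\<lambda>n. q n - 1) n))"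
        using j(3) Suc_pred[of p] Suc_pred[of q] False q j(1,2) by (metis DiffI shift_Suc)
      then have "fs (\<lambda>n. p n - 1) = fs (\<lambda>n. q n - 1)" by (auto simp: fun_eq_iff)
      then show ?thesis using False q j by (simp add: s_def f_def)
    qed
  qed simp
  then show ?thesis using s in_rel unfolding borel_selector_def by blast
qed

text \<open>The selector is transported back by undoing the shift. \<tau> takes points of the body
  rather than their first coordinates, because the projection is only shown to be Borel afterwards,
  by means of \<tau>.\<close>

lemma uniformization_if_selector:
  assumes "borel_selector (fibre_rel K) s"
  obtains \<tau> where "\<tau> \<in> borel \<rightarrow>\<^sub>M (borel :: baire measure)"
    "\<And>p. \<forall>n. K (res p n) \<Longrightarrow> (\<forall>n. K (res (\<tau> p) n)) \<and> fs (\<tau> p) = fs p"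
    "\<And>p q. \<forall>n. K (res p n) \<Longrightarrow> \<forall>n. K (res q n) \<Longrightarrow> fs p = fs q \<Longrightarrow> \<tau> p = \<tau> q"
proof
  let ?\<tau> = "\<lambda>p n. s (\<lambda>n. Suc (p n)) n - 1"
  have [measurable]: "s \<in> borel \<rightarrow>\<^sub>M borel" using assms by (simp add: borel_selector_def)
  have "(\<lambda>p. \<lambda>n. Suc (p n)) \<in> borel \<rightarrow>\<^sub>M (borel :: baire measure)"
    unfolding measurable_baire_iff by measurable
  note [measurable] = this
  show "?\<tau> \<in> borel \<rightarrow>\<^sub>M borel" unfolding measurable_baire_iff by measurable
  have shift_Suc: "(\<lambda>n. shift_fst (Suc (r n))) = (\<lambda>n. Suc (fs r n))" for r
    by (simp add: shift_fst_def fs_def)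
  show "(\<forall>n. K (res (?\<tau> p) n)) \<and> fs (?\<tau> p) = fs p" if p: "\<forall>n. K (res p n)" for p
  proof -
    let ?p = "\<lambda>n. Suc (p n)"
    have "(s ?p, ?p) \<in> fibre_rel K" using assms by (simp add: borel_selector_def)
    then have j: "s ?p \<in> junk_set K" "(\<lambda>n. shift_fst (s ?p n)) = (\<lambda>n. shift_fst (?p n))"
      using p junk_set_Suc[of p K] by (auto simp: fibre_rel_def)
    \<comment> \<open>\<open>shift_fst\<close> detects zeros, so the point selected for a sequence
      without zeros has none either.\<close>
    have "s ?p n \<noteq> 0" for n
      using fun_cong[OF j(2), of n] by (auto simp: shift_fst_def split: nat.splits)
    then have eq: "s ?p = (\<lambda>n. Suc (?\<tau> p n))" by (simp add: fun_eq_iff)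
    show ?thesis
    proof
      have "(\<lambda>n. Suc (?\<tau> p n)) \<in> junk_set K"
        by (rule subst[OF eq, of "\<lambda>x. x \<in> junk_set K"]) (rule j(1))
      then show "\<forall>n. K (res (?\<tau> p) n)" unfolding junk_set_Suc .
      have "(\<lambda>n. shift_fst (Suc (?\<tau> p n))) = (\<lambda>n. shift_fst (?p n))"
        by (rule subst[OF eq, of "\<lambda>x. (\<lambda>n. shift_fst (x n)) = _"]) (rule j(2))
      then have "(\<lambda>n. Suc (fs (?\<tau> p) n)) = (\<lambda>n. Suc (fs p n))" by (simp only: shift_Suc)
      then show "fs (?\<tau> p) = fs p" by (simp add: fun_eq_iff)
    qed
  qed
  show "?\<tau> p = ?\<tau> q" if "\<forall>n. K (res p n)" "\<forall>n. K (res q n)" "fs p = fs q" for p q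
  proof -
    have "((\<lambda>n. Suc (p n)), (\<lambda>n. Suc (q n))) \<in> fibre_rel K"
      using that by (simp add: fibre_rel_def junk_set_Suc shift_Suc)
    then have "s (\<lambda>n. Suc (p n)) = s (\<lambda>n. Suc (q n))" using assms unfolding borel_selector_def by blast
    then show ?thesis by simp
  qed
qed

text \<open>The proof of the Lusin-Souslin theorem. The set of values of \<open>\<tau>\<close> need not be closed, but the limit
  point obtained at the end only has to lie in the body of \<open>K\<close>.\<close>

lemma uniformized_projection_borel:
  assumes K: "hereditary K" and [measurable]: "\<tau> \<in> borel \<rightarrow>\<^sub>M (borel :: baire measure)"
    and \<tau>: "\<And>p. \<forall>n. K (res p n) \<Longrightarrow> (\<forall>n. K (res (\<tau> p) n)) \<and> fs (\<tau> p) = fs p"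
    and \<tau>_eq: "\<And>p q. \<forall>n. K (res p n) \<Longrightarrow> \<forall>n. K (res q n) \<Longrightarrow> fs p = fs q \<Longrightarrow> \<tau> p = \<tau> q"
  shows "fs ` {p. \<forall>n. K (res p n)} \<in> sets borel"
proof -
  define F where "F = {p. \<forall>n. K (res p n)}"
  have [measurable]: "F \<in> sets borel"
    unfolding F_def by (intro borel_closed closed_Collect_all closed_loc_const loc_const_res)
  \<comment> \<open>The elements of the projection whose chosen point starts with \<open>u\<close>.
    As \<tau> is constant on fibres, different \<open>u\<close> of the same length give disjoint
    sets.\<close>
  define A where "A u = fs ` {p. p \<in> F \<and> res (\<tau> p) (length u) = u}" for u
  have "{p \<in> space borel. p \<in> F \<and> res (\<tau> p) (length u) = u} \<in> sets borel" for u by measurable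
  then have "analytic (A u)" for u
    unfolding A_def by (intro analytic_image_borel continuous_fs) simp
  moreover have "A u \<inter> A v = {}" if "length u = length v \<and> u \<noteq> v" for u v
  proof (rule ccontr)
    assume "A u \<inter> A v \<noteq> {}"
    then obtain p q where pq: "p \<in> F" "q \<in> F" "fs p = fs q" "res (\<tau> p) (length u) = u" "res (\<tau> q) (length v) = v"
      unfolding A_def by blast
    then have "\<tau> p = \<tau> q" using \<tau>_eq[of p q] unfolding F_def by blast
    then show False using that pq(4,5) by metis
  qed
  ultimately obtain B where B: "\<And>u. B u \<in> sets borel" "\<And>u. A u \<subseteq> B u"
    "\<And>u v. length u = length v \<and> u \<noteq> v \<Longrightarrow> B u \<inter> B v = {}"
    using lusin_separation_family[of A "\<lambda>u v. length u = length v \<and> u \<noteq> v"] by metis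
  \<comment> \<open>\<open>drop k u\<close> runs through the initial segments of \<open>u\<close>;
    \<open>x\<close> has to lie in the separating set of each.\<close>
  define H where "H u = {x. K u \<and> res x (length u) = map (\<lambda>a. fst (prod_decode a)) u \<and>
     (\<forall>k. x \<in> B (drop k u))}" for u
  define Z where "Z = {x. \<forall>n. \<exists>u. length u = n \<and> x \<in> H u}"
  have H [measurable]: "H u \<in> sets borel" for u
  proof -
    note [measurable] = B(1)
    have "{x \<in> space borel. K u \<and> res x (length u) = map (\<lambda>a. fst (prod_decode a)) u \<and>
     (\<forall>k. x \<in> B (drop k u))} \<in> sets borel" by measurable
    then show ?thesis by (simp add: H_def)
  qed
  have "{x \<in> space borel. \<forall>n. \<exists>u. length u = n \<and> x \<in> H u} \<in> sets borel" by measurable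
  then have Z: "Z \<in> sets borel" by (simp add: Z_def)
  have H_tl: "x \<in> H (tl u)" if "x \<in> H u" for x u
  proof (cases u)
    case (Cons a v)
    have "\<forall>k. x \<in> B (drop k v)"
    proof
      fix k show "x \<in> B (drop k v)" using that Cons unfolding H_def by (auto dest: spec[of _ "Suc k"])
    qed
    then show ?thesis using that K Cons unfolding H_def hereditary_def by auto
  qed (use that in simp)
  have "fs ` F \<subseteq> Z"
  proof
    fix x assume "x \<in> fs ` F"
    then obtain p where p: "p \<in> F" "x = fs p" by blast
    have tp: "\<forall>n. K (res (\<tau> p) n)" "fs (\<tau> p) = x" using \<tau>[of p] p by (auto simp: F_def)
    have "x \<in> A (res (\<tau> p) n)" for n using p unfolding A_def by auto
    moreover have "drop k (res (\<tau> p) n) = res (\<tau> p) (n - k)" for n k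
      using drop_res[of "n - k" n "\<tau> p"] by (cases "k \<le> n") auto
    ultimately have "\<forall>k. x \<in> B (drop k (res (\<tau> p) n))" for n using B(2) by (metis subsetD)
    moreover have "res x n = map (\<lambda>a. fst (prod_decode a)) (res (\<tau> p) n)" for n
      unfolding tp(2)[symmetric] fs_def by (rule res_map)
    ultimately have "x \<in> H (res (\<tau> p) n)" for n using tp(1) unfolding H_def by simp
    then show "x \<in> Z" unfolding Z_def using length_res by blast
  qed
  moreover have "Z \<subseteq> fs ` F"
  proof
    fix x assume "x \<in> Z"
    then obtain u where u: "\<And>n. length (u n) = n" "\<And>n. x \<in> H (u n)" unfolding Z_def by auto metis
    have "x \<in> B v" if "x \<in> H v" for v using that unfolding H_def by (auto dest: spec[of _ 0])
    \<comment> \<open>Both nodes have length \<open>n\<close> and \<open>x\<close> lies in both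
      separating sets, so the nodes coincide.\<close>
    then have "tl (u (Suc n)) = u n" for n
      using B(3)[of "tl (u (Suc n))" "u n"] H_tl[OF u(2)[of "Suc n"]] u(2)[of n] u(1) by auto
    then obtain p where p: "\<And>n. res p n = u n" using res_coherent[of u] u(1) by blast
    have "p \<in> F" using u(2) p unfolding F_def H_def by auto
    moreover have "fs p = x"
    proof (rule res_eqI)
      fix n show "res (fs p) n = res x n"
        unfolding fs_def using u(1,2)[of n] p[of n] by (simp add: H_def res_map[of "\<lambda>a. fst (prod_decode a)" p])
    qed
    ultimately show "x \<in> fs ` F" by blast
  qed
  ultimately show ?thesis using Z unfolding F_def by simp
qed

section \<open>Hardness\<close>

text \<open>For trees, \<open>sim P X [] []\<close> says that the rank of \<open>P\<close> is at most the rank of \<open>X\<close>.\<close>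

coinductive sim :: "(nat list \<Rightarrow> bool) \<Rightarrow> (nat list \<Rightarrow> bool) \<Rightarrow> nat list \<Rightarrow> nat list \<Rightarrow> bool"
  for P X where
  "(\<And>a. P (a # s) \<Longrightarrow> \<exists>b. X (b # u) \<and> sim P X (a # s) (b # u)) \<Longrightarrow> sim P X s u"

lemma sim_iff: "sim P X s u \<longleftrightarrow> (\<forall>a. P (a # s) \<longrightarrow> (\<exists>b. X (b # u) \<and> sim P X (a # s) (b # u)))"
  by (subst sim.simps) blast

lemma sim_coinduct:
  assumes "R s u" "\<And>s u a. R s u \<Longrightarrow> P (a # s) \<Longrightarrow> \<exists>b. X (b # u) \<and> R (a # s) (b # u)"
  shows "sim P X s u"
  using assms(1)
proof (rule sim.coinduct[of R])
  fix s u assume "R s u"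
  then show "\<exists>s' u'. s = s' \<and> u = u' \<and>
      (\<forall>a. P (a # s') \<longrightarrow> (\<exists>b. X (b # u') \<and> (R (a # s') (b # u') \<or> sim P X (a # s') (b # u'))))"
    using assms(2)[OF \<open>R s u\<close>] by (intro exI[of _ s] exI[of _ u] conjI refl) meson
qed

lemma sim_refl: "sim P P s s"
  by (rule sim_coinduct[of "(=)"]) auto

lemma sim_trans:
  assumes "sim P X s u" "sim X Y u v"
  shows "sim P Y s v"
proof (rule sim_coinduct[of "\<lambda>s v. \<exists>u. sim P X s u \<and> sim X Y u v"])
  fix s v a assume "\<exists>u. sim P X s u \<and> sim X Y u v" "P (a # s)"
  then obtain u where u: "sim P X s u" "sim X Y u v" by blast
  then obtain b where b: "X (b # u)" "sim P X (a # s) (b # u)"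
    using \<open>P (a # s)\<close> sim_iff[of P X s u] by blast
  then obtain d where "Y (d # v)" "sim X Y (b # u) (d # v)"
    using u(2) sim_iff[of X Y u v] by blast
  then show "\<exists>b. Y (b # v) \<and> (\<exists>u. sim P X (a # s) u \<and> sim X Y u (b # v))" using b by blast
qed (use assms in blast)

text \<open>Comparability of ranks: if the rank of \<open>P\<close> at \<open>s\<close> exceeds that
  of \<open>X\<close> at \<open>u\<close>, some child of \<open>s\<close> still has at least the
  latter. The coinduction relates \<open>v\<close> to \<open>t\<close> when no child of
  \<open>v\<close> dominates \<open>t\<close>.\<close>

lemma sim_comparable:
  assumes "\<not> sim P X s u"
  shows "\<exists>a. P (a # s) \<and> sim X P u (a # s)"
proof -
  have step: "\<exists>a. P (a # s) \<and> (\<forall>b. X (b # u) \<longrightarrow> \<not> sim P X (a # s) (b # u))" if "\<not> sim P X s u" for s u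
    using that sim_iff[of P X s u] by blast
  from step[OF assms] obtain a where a: "P (a # s)" "\<forall>b. X (b # u) \<longrightarrow> \<not> sim P X (a # s) (b # u)"
    by blast
  have "sim X P u (a # s)"
    by (rule sim_coinduct[of "\<lambda>v t. \<forall>b. X (b # v) \<longrightarrow> \<not> sim P X t (b # v)"]) (use a step in blast)+
  then show ?thesis using a by blast
qed

section \<open>Well-founded trees and least rank\<close>

definition branchless :: "(nat list \<Rightarrow> bool) \<Rightarrow> bool" where
  "branchless P \<longleftrightarrow> (\<nexists>w. \<forall>n. P (res w (Suc n)))"

lemma wf_branchless:
  assumes "hereditary P" "branchless P"
  shows "wf {(a # s, s) |a s. P (a # s)}"
proof (rule ccontr)
  assume "\<not> ?thesis"
  then obtain f where f: "\<And>i. (f (Suc i), f i) \<in> {(a # s, s) |a s. P (a # s)}"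
    unfolding wf_iff_no_infinite_down_chain by blast
  \<comment> \<open>The chain may start at any node. Removing the newest \<open>length (f 0)\<close>
    entries leaves the segment of length \<open>n\<close> of one branch.\<close>
  define u where "u n = drop (length (f 0)) (f n)" for n
  have f': "\<exists>a. f (Suc i) = a # f i \<and> P (f (Suc i))" for i using f[of i] by auto
  have len: "length (f n) = length (f 0) + n" for n
  proof (induction n)
    case (Suc n) then show ?case using f'[of n] by auto
  qed simp
  have "tl (u (Suc n)) = u n" for n
    using f'[of n] len[of n] unfolding u_def by (cases "f 0") (auto simp: drop_Suc tl_drop)
  moreover have "length (u n) = n" for n using len[of n] by (simp add: u_def)
  ultimately obtain w where w: "\<And>n. res w n = u n" using res_coherent[of u] by blast
  have "P (u (Suc n))" for n
    unfolding u_def using hereditary_drop[OF assms(1)] f' by blast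
  then show False using assms(2) w unfolding branchless_def by metis
qed

text \<open>A simulation would carry a branch of \<open>P\<close> to an infinite path in
  \<open>X\<close> starting from \<open>u\<close>; the induction moves along this path.\<close>

lemma branchless_if_sim:
  assumes "sim P X [] u" "hereditary X" "branchless X"
  shows "branchless P"
proof -
  have "\<not> (sim P X (res w n) u \<and> (\<forall>n. P (res w (Suc n))))" for w n
    using wf_branchless[OF assms(2,3)]
  proof (induction u arbitrary: n rule: wf_induct_rule)
    case (less u)
    show ?case
    proof
      assume *: "sim P X (res w n) u \<and> (\<forall>n. P (res w (Suc n)))"
      then have "P (w n # res w n)" by (metis res.simps(2))
      then obtain b where "X (b # u)" "sim P X (w n # res w n) (b # u)"
        using * sim_iff[of P X "res w n" u] by blast
      then show False using less.IH[of "b # u" "Suc n"] * by auto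
    qed
  qed
  from this[of _ 0] show ?thesis using assms(1) unfolding branchless_def by auto
qed

lemma minimal_branchless:
  fixes P :: "'z \<Rightarrow> nat list \<Rightarrow> bool"
  assumes "\<And>z. hereditary (P z)" "branchless (P z1)"
  obtains z0 where "branchless (P z0)" "\<And>z. sim (P z0) (P z) [] []"
proof -
  \<comment> \<open>A minimal node of \<open>P z1\<close> below which some \<open>P z\<close> embeds is found in place of a minimal rank.\<close>
  have "wf {(a # s, s) |a s. P z1 (a # s)}" by (rule wf_branchless[OF assms])
  then obtain s where s: "\<exists>z. sim (P z) (P z1) [] s"
    "\<And>t. (t, s) \<in> {(a # s, s) |a s. P z1 (a # s)} \<Longrightarrow> \<not> (\<exists>z. sim (P z) (P z1) [] t)"
    using wfE_min[of _ "[]" "{s. \<exists>z. sim (P z) (P z1) [] s}"] sim_refl by (smt (verit) mem_Collect_eq)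
  then obtain z0 where z0: "sim (P z0) (P z1) [] s" by blast
  show ?thesis
  proof
    show "branchless (P z0)" using branchless_if_sim z0 assms by blast
    show "sim (P z0) (P z) [] []" for z
    proof (rule ccontr)
      assume "\<not> sim (P z0) (P z) [] []"
      \<comment> \<open>Failure of the comparison embeds \<open>P z\<close> below the child
        \<open>[a]\<close> in \<open>P z0\<close>, hence below a child of \<open>s\<close>, against
        the minimality of \<open>s\<close>.\<close>
      then obtain a where a: "P z0 [a]" "sim (P z) (P z0) [] [a]" using sim_comparable by blast
      then obtain b where "P z1 (b # s)" "sim (P z0) (P z1) [a] (b # s)"
        using z0 sim_iff[of "P z0" "P z1" "[]" s] by blast
      then show False using s(2)[of "b # s"] sim_trans[OF a(2)] by blast
    qed
  qed
qed

text \<open>An explicit simulation from the root: on nodes of a tree \<open>P\<close> the map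
  preserves length and extension, but it need not be injective.\<close>

definition tree_map :: "(nat list \<Rightarrow> bool) \<Rightarrow> (nat list \<Rightarrow> bool) \<Rightarrow> (nat list \<Rightarrow> nat list) \<Rightarrow> bool" where
  "tree_map P X g \<longleftrightarrow> g [] = [] \<and> (\<forall>a s. P (a # s) \<longrightarrow> g (a # s) \<noteq> [] \<and> tl (g (a # s)) = g s \<and> X (g (a # s)))"

lemma tree_map_sim:
  assumes "tree_map P X g"
  shows "sim P X [] []"
proof (rule sim_coinduct[of "\<lambda>s u. u = g s"])
  fix s u a assume "u = g s" "P (a # s)"
  then have "g (a # s) = hd (g (a # s)) # u" "X (g (a # s))"
    using assms unfolding tree_map_def by (metis list.collapse)+
  then show "\<exists>b. X (b # u) \<and> b # u = g (a # s)" by metis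
qed (use assms in \<open>simp add: tree_map_def\<close>)

text \<open>Among the next values that keep the simulation alive the least is taken, so that the map
  is determined by \<open>P\<close> and \<open>X\<close>.\<close>

primrec select_map :: "(nat list \<Rightarrow> bool) \<Rightarrow> (nat list \<Rightarrow> bool) \<Rightarrow> nat list \<Rightarrow> nat list" where
  "select_map P X [] = []"
| "select_map P X (a # s) =
    (LEAST b. X (b # select_map P X s) \<and> sim P X (a # s) (b # select_map P X s)) # select_map P X s"

lemma tree_map_select_map:
  assumes "hereditary P" "sim P X [] []"
  shows "tree_map P X (select_map P X)"
proof -
  have step: "X (select_map P X (a # s)) \<and> sim P X (a # s) (select_map P X (a # s))"
    if "P (a # s)" "sim P X s (select_map P X s)" for a s
  proof -
    have "\<exists>b. X (b # select_map P X s) \<and> sim P X (a # s) (b # select_map P X s)"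
      using that sim_iff[of P X s "select_map P X s"] by blast
    from LeastI_ex[OF this] show ?thesis by simp
  qed
  have "s = [] \<or> P s \<longrightarrow> sim P X s (select_map P X s)" for s
  proof (induction s)
    case (Cons a s)
    then show ?case using step[of a s] assms(1) unfolding hereditary_def by blast
  qed (use assms(2) in simp)
  then have "sim P X s (select_map P X s)" if "P (a # s)" for a s
    using that assms(1) unfolding hereditary_def by blast
  then show ?thesis unfolding tree_map_def using step by simp
qed

text \<open>Well-founded induction on the fixed tree \<open>P\<close> replaces the coinduction: each
  step adds countable quantifiers over \<open>a\<close> and \<open>b\<close> only. This is what
  makes the selector Borel when some witness tree has no branch.\<close>

lemma measurable_sim:
  assumes P: "hereditary P" "branchless P" and [measurable]: "\<And>u. Measurable.pred M (\<lambda>x. X x u)"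
  shows "Measurable.pred M (\<lambda>x. sim P (X x) s u)"
  using wf_branchless[OF P]
proof (induction s arbitrary: u rule: wf_induct_rule)
  case (less s)
  have *: "Measurable.pred M (\<lambda>x. sim P (X x) (a # s) u)" if "P (a # s)" for a u
    using less.IH[of "a # s"] that by blast
  have "Measurable.pred M (\<lambda>x. \<forall>a. P (a # s) \<longrightarrow> (\<exists>b. X x (b # u) \<and> sim P (X x) (a # s) (b # u)))"
  proof (rule pred_intros_countable(1))
    fix a show "Measurable.pred M (\<lambda>x. P (a # s) \<longrightarrow> (\<exists>b. X x (b # u) \<and> sim P (X x) (a # s) (b # u)))"
    proof (cases "P (a # s)")
      case True
      note [measurable] = *[OF True]
      show ?thesis by measurable
    qed simp
  qed
  then show ?case by (simp only: sim_iff[symmetric])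
qed

lemma measurable_select_map:
  assumes P: "hereditary P" "branchless P" and [measurable]: "\<And>u. Measurable.pred M (\<lambda>x. X x u)"
  shows "(\<lambda>x. select_map P (X x) s) \<in> M \<rightarrow>\<^sub>M count_space UNIV"
proof (induction s)
  case (Cons a s)
  note [measurable] = measurable_sim[OF P assms(3)]
  \<comment> \<open>\<open>u\<close> stands for the list chosen so far, which takes only countably
    many values.\<close>
  have "(\<lambda>x. (LEAST b. X x (b # u) \<and> sim P (X x) (a # s) (b # u)) # u) \<in> M \<rightarrow>\<^sub>M count_space UNIV" for u
    by measurable
  then show ?case
    using measurable_compose_countable[of "\<lambda>u x. (LEAST b. X x (b # u) \<and> sim P (X x) (a # s) (b # u)) # u",
        OF _ Cons] by simp
qed simp

lemma ill_founded_if_tree_map: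
  assumes "tree_map P (\<lambda>u. x (list_encode u) = 0) g" "\<not> branchless P"
  shows "x \<in> ill_founded"
proof -
  obtain w where w: "\<And>n. P (res w (Suc n))" using assms(2) unfolding branchless_def by blast
  have g: "g [] = []" "g (res w (Suc n)) \<noteq> []" "tl (g (res w (Suc n))) = g (res w n)"
    "x (list_encode (g (res w (Suc n)))) = 0" for n
    using assms(1) w[of n] unfolding tree_map_def by auto
  have "length (g (res w n)) = n" for n
  proof (induction n)
    case (Suc n)
    then show ?case
      using g(2,3)[of n] by (cases "g (res w (Suc n))") (simp_all del: res.simps)
  qed (simp add: g(1))
  then obtain v where v: "\<And>n. res v n = g (res w n)"
    using res_coherent[of "\<lambda>n. g (res w n)"] g(3) by blast
  have "\<forall>n. x (list_encode (res v (Suc n))) = 0" unfolding v by (intro allI g(4))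
  then show ?thesis unfolding ill_founded_def by blast
qed

text \<open>Each node goes to the node of the same length on a branch of \<open>x\<close>, whatever
  the tree \<open>P\<close> is.\<close>

lemma tree_map_if_ill_founded:
  assumes "x \<in> ill_founded"
  shows "\<exists>g. tree_map P (\<lambda>u. x (list_encode u) = 0) g"
proof -
  obtain v where v: "\<And>n. x (list_encode (res v (Suc n))) = 0"
    using assms unfolding ill_founded_def by blast
  have "tree_map P (\<lambda>u. x (list_encode u) = 0) (\<lambda>s. res v (length s))"
    unfolding tree_map_def using v by (auto simp del: list_encode.simps)
  then show ?thesis by blast
qed

section \<open>The reduction\<close>

definition decode_map :: "baire \<Rightarrow> nat list \<Rightarrow> nat list" where
  "decode_map \<phi> s = list_decode (\<phi> (list_encode s))"

text \<open>The tree \<open>T(y, z)\<close> with \<open>c\<close> in place of \<open>y\<close>. For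
  closed \<open>D\<close> its branches are the \<open>u\<close> with \<open>pr (pr c z) u\<close> in
  \<open>D\<close>, so \<open>z\<close> is a witness when there are none.\<close>

definition witness_tree :: "baire set \<Rightarrow> baire \<Rightarrow> baire \<Rightarrow> nat list \<Rightarrow> bool" where
  "witness_tree D c z s = section_tree D (res (pr c z) (length s)) s"

text \<open>The points are coded \<open>(c, x, z, \<phi>)\<close>, where \<open>\<phi>\<close> maps the witness tree of \<open>(c, z)\<close> into the tree \<open>x\<close>.\<close>

definition map_space :: "baire set \<Rightarrow> baire set" where
  "map_space D = {q. tree_map (witness_tree D (fs q) (fs (sn (sn q))))
     (\<lambda>u. fs (sn q) (list_encode u) = 0) (decode_map (sn (sn (sn q))))}"

text \<open>The tree of the section of \<open>map_space D\<close> at \<open>c\<close>. Each node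
  depends on finitely many values of \<open>c\<close>, which gives the Borel dependence of the
  relation on \<open>c\<close>.\<close>

definition map_tree :: "baire set \<Rightarrow> baire \<Rightarrow> nat list \<Rightarrow> bool" where
  "map_tree D c s = section_tree (map_space D) (res c (length s)) s"

text \<open>Each clause of \<open>tree_map\<close>, for a fixed node, is decided by finitely many
  values of the point.\<close>

lemma closed_map_space: "closed (map_space D)"
proof -
  have fs: "loc_const (\<lambda>q. fs (f q) i)" if "continuous_on UNIV f" for f i
    using continuous_on_compose2[OF continuous_fs that] by (simp add: continuous_iff_loc_const)
  have sn: "loc_const (\<lambda>q. sn (f q) i)" if "continuous_on UNIV f" for f i
    using continuous_on_compose2[OF continuous_sn that] by (simp add: continuous_iff_loc_const)
  have sns: "continuous_on UNIV (\<lambda>q. sn (sn q))" "continuous_on UNIV (\<lambda>q::baire. q)"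
    using continuous_on_compose2[OF continuous_sn continuous_sn] by auto
  have g: "loc_const (\<lambda>q. decode_map (sn (sn (sn q))) s)" for s
    unfolding decode_map_def by (rule loc_const_comp[OF sn[OF sns(1)]])
  have W: "loc_const (\<lambda>q. witness_tree D (fs q) (fs (sn (sn q))) s)" for s
    unfolding witness_tree_def
    by (rule loc_const_comp[OF loc_const_map_res[where F = "\<lambda>q. pr (fs q) (fs (sn (sn q)))"]], unfold pr_def,
        rule loc_const_comp2[where h = "\<lambda>a b. prod_encode (a, b)"], rule fs[OF sns(2)], rule fs[OF sns(1)])
  have X: "loc_const (\<lambda>q. fs (sn q) (list_encode (decode_map (sn (sn (sn q))) s)) = 0)" for s
    by (rule loc_const_comp[OF loc_const_app[where F = "\<lambda>q i. fs (sn q) i"], where h = "\<lambda>a. a = 0"],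
        rule fs[OF continuous_sn], rule loc_const_comp[OF g])
  show ?thesis
    unfolding map_space_def tree_map_def
    by (intro closed_Collect_conj closed_Collect_all closed_Collect_imp open_loc_const[OF W] closed_loc_const[OF X]
      closed_loc_const[OF loc_const_comp[OF g, of "\<lambda>l. l = []"]]
      closed_loc_const[OF loc_const_comp[OF g, of "\<lambda>l. l \<noteq> []"]]
      closed_loc_const[OF loc_const_comp2[OF g g, of "\<lambda>l m. tl l = m"]])
qed

lemma hereditary_witness_tree: "hereditary (witness_tree D c z)"
  unfolding hereditary_def witness_tree_def using section_tree_Cons by auto

lemma hereditary_map_tree: "hereditary (map_tree D c)"
  unfolding hereditary_def map_tree_def using section_tree_Cons by auto

lemma branchless_witness_tree:
  assumes "closed D"
  shows "branchless (witness_tree D c z) \<longleftrightarrow> (\<nexists>u. pr (pr c z) u \<in> D)"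
  unfolding branchless_def witness_tree_def length_res
  using section_tree_branch[OF assms] section_tree_mem by metis

lemma map_tree_branch: "(\<forall>n. map_tree D c (res p n)) \<longleftrightarrow> pr c p \<in> map_space D"
  unfolding map_tree_def length_res
  using section_tree_branch[OF closed_map_space] section_tree_mem by metis

lemma pr_mem_map_space: "pr c p \<in> map_space D \<longleftrightarrow>
  tree_map (witness_tree D c (fs (sn p))) (\<lambda>u. fs p (list_encode u) = 0) (decode_map (sn (sn p)))"
  by (simp add: map_space_def)

lemma map_tree_Sel:
  assumes "closed D"
  shows "fibre_rel (map_tree D c) \<in> Sel \<longleftrightarrow> (\<exists>z. \<nexists>u. pr (pr c z) u \<in> D)"
proof -
  let ?K = "map_tree D c" and ?P = "witness_tree D c"
  let ?X = "\<lambda>x u. x (list_encode u) = (0::nat)"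
  have Sel: "fibre_rel ?K \<in> Sel \<longleftrightarrow> (\<exists>s. borel_selector (fibre_rel ?K) s)"
    using closed_fibre_rel[OF hereditary_map_tree] equiv_fibre_rel by (simp add: Sel_def effros_def space_measure_of_conv)
  have "\<exists>s. borel_selector (fibre_rel ?K) s" if z1: "branchless (?P z1)" for z1
  proof -
    obtain z0 where z0: "branchless (?P z0)" "\<And>z. sim (?P z0) (?P z) [] []"
      using minimal_branchless[of ?P, OF hereditary_witness_tree z1] by blast
    define \<phi> where "\<phi> x = (\<lambda>k. list_encode (select_map (?P z0) (?X x) (list_decode k)))" for x
    have [measurable]: "\<phi> \<in> borel \<rightarrow>\<^sub>M borel"
      unfolding measurable_baire_iff \<phi>_def
    proof
      fix k
      have "(\<lambda>x. select_map (?P z0) (?X x) (list_decode k)) \<in> borel \<rightarrow>\<^sub>M count_space UNIV"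
        by (rule measurable_select_map[OF hereditary_witness_tree z0(1)]) measurable
      then show "(\<lambda>x. list_encode (select_map (?P z0) (?X x) (list_decode k))) \<in> borel \<rightarrow>\<^sub>M count_space UNIV"
        by (rule measurable_compose[OF _ measurable_count_space])
    qed
    show ?thesis
    proof (rule selector_if_uniformization[OF hereditary_map_tree, where \<sigma> = "\<lambda>x. pr x (pr z0 (\<phi> x))"])
      show "(\<lambda>x. pr x (pr z0 (\<phi> x))) \<in> borel \<rightarrow>\<^sub>M borel" by measurable
      fix p assume "\<forall>n. ?K (res p n)"
      then have "tree_map (?P (fs (sn p))) (?X (fs p)) (decode_map (sn (sn p)))"
        by (simp add: map_tree_branch pr_mem_map_space)
      \<comment> \<open>The tree of \<open>z0\<close> has least rank, so it embeds into the tree of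
        the parameter in \<open>p\<close> and from there into the tree \<open>fs p\<close>.\<close>
      then have "sim (?P z0) (?X (fs p)) [] []"
        using tree_map_sim sim_trans[OF z0(2)] by blast
      then have "tree_map (?P z0) (?X (fs p)) (select_map (?P z0) (?X (fs p)))"
        by (rule tree_map_select_map[OF hereditary_witness_tree])
      moreover have "decode_map (\<phi> x) = select_map (?P z0) (?X x)" for x
        by (simp add: fun_eq_iff decode_map_def \<phi>_def)
      ultimately show "(\<forall>n. ?K (res (pr (fs p) (pr z0 (\<phi> (fs p)))) n)) \<and> fs (pr (fs p) (pr z0 (\<phi> (fs p)))) = fs p"
        by (simp add: map_tree_branch pr_mem_map_space)
    qed
  qed
  moreover have "\<exists>z. branchless (?P z)" if s: "borel_selector (fibre_rel ?K) s" for s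
  proof (rule ccontr)
    assume "\<nexists>z. branchless (?P z)"
    then have ill: "\<And>z. \<not> branchless (?P z)" by blast
    \<comment> \<open>Every witness tree now has a branch, which a map into \<open>x\<close> turns
      into a branch of \<open>x\<close>; conversely, an ill-founded \<open>x\<close> receives the
      tree of any parameter, here \<open>undefined\<close>.\<close>
    have "fs ` {p. \<forall>n. ?K (res p n)} = ill_founded"
    proof (intro equalityI subsetI)
      fix x assume "x \<in> fs ` {p. \<forall>n. ?K (res p n)}"
      then obtain p where "pr c p \<in> map_space D" "x = fs p" by (auto simp: map_tree_branch)
      then show "x \<in> ill_founded" using ill_founded_if_tree_map ill unfolding pr_mem_map_space by blast
    next
      fix x assume "x \<in> ill_founded"
      then obtain g where g: "tree_map (?P undefined) (?X x) g" using tree_map_if_ill_founded by blast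
      define \<phi> where "\<phi> = (\<lambda>k. list_encode (g (list_decode k)))"
      have "decode_map \<phi> = g" by (simp add: fun_eq_iff decode_map_def \<phi>_def)
      then have "pr c (pr x (pr undefined \<phi>)) \<in> map_space D" using g by (simp add: pr_mem_map_space)
      then show "x \<in> fs ` {p. \<forall>n. ?K (res p n)}"
        by (intro image_eqI[of _ _ "pr x (pr undefined \<phi>)"]) (simp_all add: map_tree_branch)
    qed
    moreover obtain \<tau> where "\<tau> \<in> borel \<rightarrow>\<^sub>M (borel :: baire measure)"
      "\<And>p. \<forall>n. ?K (res p n) \<Longrightarrow> (\<forall>n. ?K (res (\<tau> p) n)) \<and> fs (\<tau> p) = fs p"
      "\<And>p q. \<forall>n. ?K (res p n) \<Longrightarrow> \<forall>n. ?K (res q n) \<Longrightarrow> fs p = fs q \<Longrightarrow> \<tau> p = \<tau> q"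
      using uniformization_if_selector[OF s] by blast
    from uniformized_projection_borel[OF hereditary_map_tree this]
    have "fs ` {p. \<forall>n. ?K (res p n)} \<in> sets borel" .
    ultimately show False using ill_founded_not_borel by simp
  qed
  ultimately show ?thesis unfolding Sel branchless_witness_tree[OF assms, symmetric] by blast
qed

text \<open>A closed matrix in place of a Borel one costs a longer witness: \<open>u\<close> codes
  \<open>w\<close> together with a witness for membership in the Borel set.\<close>

lemma suslin_in_parameters:
  assumes [measurable]: "Q \<in> sets (borel :: baire measure)"
  obtains D where "closed D" "\<And>c z. (\<exists>w. pr c (pr z w) \<in> Q) \<longleftrightarrow> (\<exists>u. pr (pr c z) u \<in> D)"
proof -
  have "{q \<in> space borel. pr (fs (fs q)) (pr (sn (fs q)) (sn q)) \<in> Q} \<in> sets borel" by measurable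
  then obtain C where C: "closed C"
    "\<And>x. pr (fs (fs x)) (pr (sn (fs x)) (sn x)) \<in> Q \<longleftrightarrow> (\<exists>v. pr x v \<in> C)"
    using borel_suslin unfolding suslin_def by fastforce
  let ?D = "{q. pr (pr (fs q) (fs (sn q))) (sn (sn q)) \<in> C}"
  have "closed ?D"
    using continuous_on_compose2[OF continuous_fs continuous_sn] continuous_on_compose2[OF continuous_sn continuous_sn]
    by (intro closed_vimage_UNIV[OF C(1)] continuous_pr continuous_fs) auto
  moreover have "(\<exists>w. pr c (pr z w) \<in> Q) \<longleftrightarrow> (\<exists>u. pr (pr c z) u \<in> ?D)" for c z
  proof -
    have "(\<exists>w. pr c (pr z w) \<in> Q) \<longleftrightarrow> (\<exists>w v. pr (pr (pr c z) w) v \<in> C)"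
      using C(2)[of "pr (pr c z) _"] by simp
    also have "\<dots> \<longleftrightarrow> (\<exists>u. pr (pr c z) u \<in> ?D)"
      by (simp, metis fs_pr sn_pr)
    finally show ?thesis .
  qed
  ultimately show ?thesis using that by blast
qed

lemma mem_fst_image: "a \<in> fst ` S \<longleftrightarrow> (\<exists>b. (a, b) \<in> S)"
  by force

text \<open>The measurable map \<open>g\<close> moves the description of \<open>B\<close> into Baire
  space, where its matrix becomes a closed set \<open>D\<close>; the tree belonging to
  \<open>g y\<close> then gives the reduction.\<close>

lemma Sel_hard:
  assumes "B \<in> Sigma12 Y"
  shows "\<exists>f \<in> Y \<rightarrow>\<^sub>M effros. f -` Sel \<inter> space Y = B"
proof -
  obtain Q where Q [measurable]: "Q \<in> sets ((Y \<Otimes>\<^sub>M (borel :: baire measure)) \<Otimes>\<^sub>M (borel :: baire measure))"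
    and B: "B = fst ` (space (Y \<Otimes>\<^sub>M (borel :: baire measure)) - fst ` Q)"
    using assms unfolding Sigma12_def Pi11_def Sigma11_def by blast
  \<comment> \<open>The two quantified points are merged into one, because the pullback handles a
    single factor of Baire space.\<close>
  let ?Q = "{q \<in> space (Y \<Otimes>\<^sub>M borel). ((fst q, fs (snd q)), sn (snd q)) \<in> Q}"
  have "?Q \<in> sets (Y \<Otimes>\<^sub>M borel)" by measurable
  from sets_pair_borel_pullback[OF this]
  obtain g Q' where g [measurable]: "g \<in> Y \<rightarrow>\<^sub>M (borel :: baire measure)" and Q': "Q' \<in> sets (borel :: baire measure)"
    and gQ: "\<And>y v. y \<in> space Y \<Longrightarrow> (y, v) \<in> ?Q \<longleftrightarrow> pr (g y) v \<in> Q'" by blast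
  obtain D where D: "closed D" "\<And>c z. (\<exists>w. pr c (pr z w) \<in> Q') \<longleftrightarrow> (\<exists>u. pr (pr c z) u \<in> D)"
    using suslin_in_parameters[OF Q'] by blast
  have Q_iff: "((y, z), w) \<in> Q \<longleftrightarrow> pr (g y) (pr z w) \<in> Q'" if "y \<in> space Y" for y z w
    using gQ[OF that, of "pr z w"] that by (simp add: space_pair_measure)
  have B_iff: "y \<in> B \<longleftrightarrow> (\<exists>z. \<nexists>u. pr (pr (g y) z) u \<in> D)" if "y \<in> space Y" for y
  proof -
    have "y \<in> B \<longleftrightarrow> (\<exists>z. \<nexists>w. ((y, z), w) \<in> Q)"
      using that by (simp add: B mem_fst_image space_pair_measure)
    then show ?thesis using Q_iff[OF that] D(2) by simp
  qed
  have [measurable]: "Measurable.pred borel (\<lambda>c. map_tree D c s)" for s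
    unfolding map_tree_def by measurable
  have "(\<lambda>y. fibre_rel (map_tree D (g y))) \<in> Y \<rightarrow>\<^sub>M effros"
    by (intro measurable_fibre_rel hereditary_map_tree) measurable
  moreover have "(\<lambda>y. fibre_rel (map_tree D (g y))) -` Sel \<inter> space Y = B"
  proof (rule set_eqI)
    fix y
    have "B \<subseteq> space Y" unfolding B by (auto simp: space_pair_measure)
    moreover have "y \<in> (\<lambda>y. fibre_rel (map_tree D (g y))) -` Sel \<inter> space Y \<longleftrightarrow>
        y \<in> space Y \<and> (\<exists>z. \<nexists>u. pr (pr (g y) z) u \<in> D)"
      by (auto simp only: vimage_eq Int_iff map_tree_Sel[OF D(1)])
    ultimately show "y \<in> (\<lambda>y. fibre_rel (map_tree D (g y))) -` Sel \<inter> space Y \<longleftrightarrow> y \<in> B"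
      using B_iff by blast
  qed
  ultimately show ?thesis by blast
qed

section \<open>The upper bound\<close>

text \<open>A point lies in a closed set when all its basic neighbourhoods meet the set. There are
  countably many of them, and meeting a given one is a generating event of the Effros
  structure.\<close>

lemma pred_mem_effros:
  assumes f: "f \<in> M \<rightarrow>\<^sub>M (effros :: (baire \<times> baire) set measure)"
    and [measurable]: "a \<in> M \<rightarrow>\<^sub>M (borel :: baire measure)" "b \<in> M \<rightarrow>\<^sub>M (borel :: baire measure)"
  shows "Measurable.pred M (\<lambda>c. (a c, b c) \<in> f c)"
proof -
  define U where "U n s t = {x :: baire. res x n = s} \<times> {y :: baire. res y n = t}" for n s t
  have [measurable]: "Measurable.pred M (\<lambda>c. f c \<inter> U n s t \<noteq> {})" for n s t
  proof -
    have "{F. closed F \<and> F \<inter> U n s t \<noteq> {}} \<in> sets effros"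
    proof -
      have "open (U n s t)" unfolding U_def by (intro open_Times open_res)
      then show ?thesis unfolding effros_def by (intro in_measure_of) blast+
    qed
    from measurable_sets[OF f this]
    have "f -` {F. closed F \<and> F \<inter> U n s t \<noteq> {}} \<inter> space M \<in> sets M" .
    also have "f -` {F. closed F \<and> F \<inter> U n s t \<noteq> {}} \<inter> space M = {c \<in> space M. f c \<inter> U n s t \<noteq> {}}"
      using measurable_space[OF f] by (auto simp: effros_def space_measure_of_conv)
    finally show ?thesis by simp
  qed
  \<comment> \<open>Quantifying over \<open>s\<close> and \<open>t\<close> keeps the neighbourhood
    from varying with \<open>c\<close>.\<close>
  have "Measurable.pred M (\<lambda>c. \<forall>n. \<exists>s t. res (a c) n = s \<and> res (b c) n = t \<and> f c \<inter> U n s t \<noteq> {})"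
    by measurable
  moreover have "(a c, b c) \<in> f c \<longleftrightarrow> (\<forall>n. \<exists>s t. res (a c) n = s \<and> res (b c) n = t \<and> f c \<inter> U n s t \<noteq> {})"
    if "c \<in> space M" for c
  proof
    assume "(a c, b c) \<in> f c"
    then show "\<forall>n. \<exists>s t. res (a c) n = s \<and> res (b c) n = t \<and> f c \<inter> U n s t \<noteq> {}"
      unfolding U_def by blast
  next
    assume *: "\<forall>n. \<exists>s t. res (a c) n = s \<and> res (b c) n = t \<and> f c \<inter> U n s t \<noteq> {}"
    have "closed (f c)" using measurable_space[OF f that] by (auto simp: effros_def space_measure_of_conv)
    show "(a c, b c) \<in> f c"
    proof (rule ccontr)
      assume "(a c, b c) \<notin> f c"
      then obtain n where n: "\<And>x' y'. res x' n = res (a c) n \<Longrightarrow> res y' n = res (b c) n \<Longrightarrow> (x', y') \<in> - f c"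
        using open_contains_res2[of "- f c" "a c" "b c"] \<open>closed (f c)\<close> by (auto simp: open_Compl)
      then show False using * unfolding U_def by blast
    qed
  qed
  ultimately show ?thesis by (subst measurable_cong) auto
qed

text \<open>A Borel code is a well-founded relation on the nodes together with a basic open set at each node;
  a node denotes the union of its basic open set with the complements of its children. In
  \<open>basic\<close>, 0 stands for the empty set.\<close>

definition basic :: "nat \<Rightarrow> baire set" where
  "basic m = {x. m \<noteq> 0 \<and> res x (length (list_decode (m - 1))) = list_decode (m - 1)}"

definition child :: "baire \<Rightarrow> nat \<Rightarrow> nat \<Rightarrow> bool" where
  "child c i j \<longleftrightarrow> sn c (prod_encode (i, j)) = 0"

definition valuation :: "baire \<Rightarrow> (nat \<Rightarrow> baire set) \<Rightarrow> bool" where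
  "valuation c v \<longleftrightarrow> (\<forall>i. v i = basic (fs c i) \<union> (\<Union>j\<in>{j. child c i j}. - v j))"

text \<open>A valuation seen from one point \<open>x\<close>, nonzero meaning membership. It lets
  the coded sets be used while quantifying over points of Baire space only.\<close>

definition evaluation :: "baire \<Rightarrow> baire \<Rightarrow> baire \<Rightarrow> bool" where
  "evaluation c x e \<longleftrightarrow> (\<forall>i. e i \<noteq> 0 \<longleftrightarrow> x \<in> basic (fs c i) \<or> (\<exists>j. child c i j \<and> e j = 0))"

definition wf_code :: "baire \<Rightarrow> bool" where
  "wf_code c \<longleftrightarrow> (\<nexists>f. \<forall>n. child c (f n) (f (Suc n)))"

lemma wf_code_wf: "wf_code c \<Longrightarrow> wf {(j, i). child c i j}"
  unfolding wf_code_def wf_iff_no_infinite_down_chain by simp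

lemma wf_code_valuation:
  assumes "wf_code c"
  shows "\<exists>v. valuation c v"
proof -
  define F where "F = (\<lambda>v i. basic (fs c i) \<union> (\<Union>j\<in>{j. child c i j}. - v j))"
  have "wfrec {(j, i). child c i j} F i = F (wfrec {(j, i). child c i j} F) i" for i
    by (subst wfrec[OF wf_code_wf[OF assms]]) (simp add: F_def cut_apply)
  then show ?thesis unfolding valuation_def F_def by blast
qed

lemma valuation_borel:
  assumes "wf_code c" "valuation c v"
  shows "v i \<in> sets borel"
  using wf_code_wf[OF assms(1)]
proof (induction i rule: wf_induct_rule)
  case (less i)
  have "basic m \<in> sets borel" for m
    unfolding basic_def by (intro borel_open open_loc_const loc_const_res)
  moreover have "(\<Union>j\<in>{j. child c i j}. - v j) \<in> sets borel"
    using less by (intro sets.countable_UN'') auto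
  ultimately show ?case using assms(2) unfolding valuation_def by (metis sets.Un)
qed

text \<open>Both sides obey the same recursion along the well-founded relation \<open>child\<close>,
  so an evaluation is unique up to the choice of nonzero values.\<close>

lemma evaluation_iff_valuation:
  assumes "wf_code c" "valuation c v"
  shows "evaluation c x e \<longleftrightarrow> (\<forall>i. e i \<noteq> 0 \<longleftrightarrow> x \<in> v i)"
proof
  assume e: "evaluation c x e"
  have "e i \<noteq> 0 \<longleftrightarrow> x \<in> v i" for i
    using wf_code_wf[OF assms(1)]
  proof (induction i rule: wf_induct_rule)
    case (less i)
    have "x \<in> v i \<longleftrightarrow> x \<in> basic (fs c i) \<or> (\<exists>j. child c i j \<and> x \<notin> v j)"
      using assms(2) unfolding valuation_def by blast
    moreover have "e i \<noteq> 0 \<longleftrightarrow> x \<in> basic (fs c i) \<or> (\<exists>j. child c i j \<and> e j = 0)"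
      using e unfolding evaluation_def by blast
    moreover have "child c i j \<Longrightarrow> e j = 0 \<longleftrightarrow> x \<notin> v j" for j using less[of j] by auto
    ultimately show ?case by blast
  qed
  then show "\<forall>i. e i \<noteq> 0 \<longleftrightarrow> x \<in> v i" by blast
next
  assume e: "\<forall>i. e i \<noteq> 0 \<longleftrightarrow> x \<in> v i"
  show "evaluation c x e"
    unfolding evaluation_def
  proof
    fix i
    have "x \<in> v i \<longleftrightarrow> x \<in> basic (fs c i) \<or> (\<exists>j. child c i j \<and> x \<notin> v j)"
      using assms(2) unfolding valuation_def by blast
    then show "e i \<noteq> 0 \<longleftrightarrow> x \<in> basic (fs c i) \<or> (\<exists>j. child c i j \<and> e j = 0)"
      using e by blast
  qed
qed

section \<open>Codes of Borel sets\<close>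

definition make_code :: "(nat \<Rightarrow> nat) \<Rightarrow> (nat \<Rightarrow> nat \<Rightarrow> bool) \<Rightarrow> baire" where
  "make_code l ch = pr l (\<lambda>k. if ch (fst (prod_decode k)) (snd (prod_decode k)) then 0 else 1)"

lemma fs_make_code [simp]: "fs (make_code l ch) = l"
  and child_make_code [simp]: "child (make_code l ch) = ch"
  by (simp_all add: make_code_def child_def fun_eq_iff)

definition coded :: "baire set \<Rightarrow> bool" where
  "coded A \<longleftrightarrow> (\<exists>c v. wf_code c \<and> valuation c v \<and> v 0 = A)"

text \<open>The codes are placed side by side, node \<open>i\<close> of the \<open>n\<close>-th
  becoming \<open>prod_encode (n, i)\<close>. One point can thus code all the digit sets of a
  selector.\<close>

lemma coded_family:
  assumes "\<And>n. coded (A n)"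
  shows "\<exists>c v. wf_code c \<and> valuation c v \<and> (\<forall>n. v (prod_encode (n, 0)) = A n)"
proof -
  obtain c where "\<forall>n. \<exists>v. wf_code (c n) \<and> valuation (c n) v \<and> v 0 = A n"
    using assms unfolding coded_def by metis
  then obtain v where c: "\<And>n. wf_code (c n)" and v: "\<And>n. valuation (c n) (v n)" and A: "\<And>n. v n 0 = A n"
    by metis
  define l where "l k = fs (c (fst (prod_decode k))) (snd (prod_decode k))" for k
  define ch where "ch k k' \<longleftrightarrow> fst (prod_decode k) = fst (prod_decode k') \<and>
    child (c (fst (prod_decode k))) (snd (prod_decode k)) (snd (prod_decode k'))" for k k'
  define u where "u k = v (fst (prod_decode k)) (snd (prod_decode k))" for k
  have "wf_code (make_code l ch)"
    unfolding wf_code_def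
  proof
    assume "\<exists>f. \<forall>n. child (make_code l ch) (f n) (f (Suc n))"
    then obtain f where f: "\<And>n. ch (f n) (f (Suc n))" by auto
    have "fst (prod_decode (f n)) = fst (prod_decode (f 0))" for n
      by (induction n) (use f in \<open>auto simp: ch_def\<close>)
    then have "child (c (fst (prod_decode (f 0)))) (snd (prod_decode (f n))) (snd (prod_decode (f (Suc n))))" for n
      using f[of n] unfolding ch_def by metis
    then have "\<exists>g. \<forall>n. child (c (fst (prod_decode (f 0)))) (g n) (g (Suc n))"
      by (intro exI[of _ "\<lambda>n. snd (prod_decode (f n))"]) blast
    then show False using c unfolding wf_code_def by blast
  qed
  moreover have "valuation (make_code l ch) u"
    unfolding valuation_def
  proof
    fix k
    obtain n i where k: "k = prod_encode (n, i)" by (metis prod_decode_inverse surj_pair)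
    have eq: "(\<Union>j\<in>{j. child (c n) i j}. - v n j) = (\<Union>k'\<in>{k'. ch k k'}. - u k')"
      unfolding ch_def u_def k by (force intro: exI[of _ "prod_encode (n, _)"])
    then show "u k = basic (fs (make_code l ch) k) \<union> (\<Union>k'\<in>{k'. child (make_code l ch) k k'}. - u k')"
    proof -
      have "v n i = basic (fs (c n) i) \<union> (\<Union>j\<in>{j. child (c n) i j}. - v n j)"
        using v[of n] unfolding valuation_def by (rule spec)
      moreover have "u k = v n i" "l k = fs (c n) i" by (simp_all add: u_def l_def k)
      ultimately show ?thesis using eq by (simp only: fs_make_code child_make_code)
    qed
  qed
  moreover have "u (prod_encode (n, 0)) = A n" for n by (simp add: u_def A)
  ultimately show ?thesis by blast
qed

text \<open>The old nodes move up by one, and the new node 0, whose basic set is empty, gets the old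
  roots as its children.\<close>

lemma coded_Union_Compl:
  assumes "\<And>n::nat. coded (A n)"
  shows "coded (\<Union>n. - A n)"
proof -
  obtain c v where c: "wf_code c" and v: "valuation c v" and A: "\<And>n. v (prod_encode (n, 0)) = A n"
    using coded_family[of A] assms by blast
  define l where "l = case_nat 0 (fs c)"
  define ch where "ch k k' \<longleftrightarrow> (case k' of 0 \<Rightarrow> False | Suc j \<Rightarrow>
    (case k of 0 \<Rightarrow> (\<exists>n. j = prod_encode (n, 0)) | Suc i \<Rightarrow> child c i j))" for k k'
  define u where "u = case_nat (\<Union>n. - A n) v"
  have "wf_code (make_code l ch)"
    unfolding wf_code_def
  proof
    assume "\<exists>f. \<forall>n. child (make_code l ch) (f n) (f (Suc n))"
    then obtain f where f: "\<And>n. ch (f n) (f (Suc n))" by auto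
    \<comment> \<open>Node 0 is nobody's child, so after its first node a path stays inside the old
      code.\<close>
    have "child c (f (Suc n) - 1) (f (Suc (Suc n)) - 1)" for n
      using f[of n] f[of "Suc n"] by (auto simp: ch_def split: nat.splits)
    then have "\<exists>g. \<forall>n. child c (g n) (g (Suc n))" by (intro exI[of _ "\<lambda>n. f (Suc n) - 1"]) blast
    then show False using c unfolding wf_code_def by blast
  qed
  moreover have "valuation (make_code l ch) u"
    unfolding valuation_def
  proof
    fix k
    show "u k = basic (fs (make_code l ch) k) \<union> (\<Union>k'\<in>{k'. child (make_code l ch) k k'}. - u k')"
    proof (cases k)
      case 0
      have "ch 0 k' \<longleftrightarrow> (\<exists>n. k' = Suc (prod_encode (n, 0)))" for k'
        by (cases k') (auto simp: ch_def)
      then have "{k'. ch 0 k'} = range (\<lambda>n. Suc (prod_encode (n, 0)))" by auto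
      then show ?thesis using 0 by (simp add: u_def l_def basic_def A)
    next
      case (Suc i)
      have "ch (Suc i) k' \<longleftrightarrow> k' \<in> Suc ` {j. child c i j}" for k'
        by (cases k') (auto simp: ch_def)
      then have "(\<Union>k'\<in>{k'. ch k k'}. - u k') = (\<Union>j\<in>{j. child c i j}. - v j)"
        by (simp add: Suc u_def)
      moreover have "v i = basic (fs c i) \<union> (\<Union>j\<in>{j. child c i j}. - v j)"
        using v unfolding valuation_def by (rule spec)
      moreover have "u k = v i" "l k = fs c i" by (simp_all add: u_def l_def Suc)
      ultimately show ?thesis by (simp only: fs_make_code child_make_code)
    qed
  qed
  moreover have "u 0 = (\<Union>n. - A n)" by (simp add: u_def)
  ultimately show ?thesis unfolding coded_def by blast
qed

lemma coded_Compl: "coded A \<Longrightarrow> coded (- A)"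
  using coded_Union_Compl[of "\<lambda>_. A"] by simp

lemma coded_Union:
  assumes "\<And>n::nat. coded (A n)"
  shows "coded (\<Union>n. A n)"
  using coded_Union_Compl[of "\<lambda>n. - A n"] coded_Compl assms by simp

lemma coded_basic: "coded (basic m)"
  unfolding coded_def
  by (intro exI[of _ "make_code (\<lambda>_. m) (\<lambda>_ _. False)"] exI[of _ "\<lambda>_. basic m"])
    (simp add: wf_code_def valuation_def)

lemma coded_open:
  assumes "open U"
  shows "coded U"
proof -
  define B where "B m = (if basic m \<subseteq> U then basic m else basic 0)" for m
  have "basic 0 = {}" by (simp add: basic_def)
  have "\<exists>m. x \<in> B m" if x: "x \<in> U" for x
  proof -
    obtain n where n: "\<And>y. res y n = res x n \<Longrightarrow> y \<in> U" using open_contains_res[OF assms x] by blast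
    let ?m = "Suc (list_encode (res x n))"
    have "basic ?m \<subseteq> U" "x \<in> basic ?m" using n by (auto simp: basic_def)
    then show ?thesis unfolding B_def by (intro exI[of _ ?m]) simp
  qed
  moreover have "B m \<subseteq> U" for m using \<open>basic 0 = {}\<close> by (simp add: B_def)
  ultimately have "U = (\<Union>m. B m)" by blast
  moreover have "coded (B m)" for m by (simp add: B_def coded_basic)
  ultimately show ?thesis using coded_Union[of B] by simp
qed

lemma coded_borel:
  assumes "A \<in> sets (borel :: baire measure)"
  shows "coded A"
proof -
  have "A \<in> sigma_sets UNIV {S :: baire set. open S}"
    using assms by (simp add: borel_def)
  then show ?thesis
  proof (induction rule: sigma_sets.induct)
    case Empty show ?case by (rule coded_open) simp
  next
    case (Compl a) then show ?case by (simp add: Compl_eq_Diff_UNIV[symmetric] coded_Compl)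
  qed (auto intro: coded_open coded_Union)
qed

text \<open>The root, in a code for a family, of the set of points whose selected value at place
  \<open>n\<close> is \<open>k\<close>.\<close>

definition digit_node :: "nat \<Rightarrow> nat \<Rightarrow> nat" where
  "digit_node n k = prod_encode (prod_encode (n, k), 0)"

text \<open>Evaluations are unique for well-founded codes, so it suffices to quantify over them universally.
  This makes the existence of a suitable code \<open>\<Sigma>\<^sup>1\<^sub>2\<close>. That some digit \<open>k\<close> exists is all that has to be
  required of \<open>e\<close>: the selector then takes the least one.\<close>

definition selector_code ::
  "(baire \<times> baire) set \<Rightarrow> baire \<Rightarrow> baire \<Rightarrow> baire \<Rightarrow> baire \<Rightarrow> baire \<Rightarrow> baire \<Rightarrow> baire \<Rightarrow> baire \<Rightarrow> bool" where
  "selector_code E c f x y z e e' w \<longleftrightarrow>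
    \<not> (\<forall>n. child c (f n) (f (Suc n))) \<and>
    (x, x) \<in> E \<and> ((x, y) \<in> E \<longrightarrow> (y, x) \<in> E) \<and> ((x, y) \<in> E \<and> (y, z) \<in> E \<longrightarrow> (x, z) \<in> E) \<and>
    (evaluation c x e \<longrightarrow> (\<forall>n. \<exists>k. e (digit_node n k) \<noteq> 0)) \<and>
    (evaluation c x e \<and> (\<forall>n. e (digit_node n (w n)) \<noteq> 0) \<longrightarrow> (w, x) \<in> E) \<and>
    (evaluation c x e \<and> evaluation c y e' \<and> (x, y) \<in> E \<longrightarrow>
      (\<forall>n k. e (digit_node n k) \<noteq> 0 \<longleftrightarrow> e' (digit_node n k) \<noteq> 0))"

lemma Sel_iff_selector_code:
  "E \<in> Sel \<longleftrightarrow> closed E \<and> (\<exists>c. \<forall>f x y z e e' w. selector_code E c f x y z e e' w)"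
proof
  assume "E \<in> Sel"
  then obtain s where E: "closed E" "equiv UNIV E" and s: "borel_selector E s"
    by (auto simp: Sel_def effros_def space_measure_of_conv)
  have [measurable]: "s \<in> borel \<rightarrow>\<^sub>M borel" and sE: "\<And>x. (s x, x) \<in> E" "\<And>x y. (x, y) \<in> E \<Longrightarrow> s x = s y"
    using s unfolding borel_selector_def by blast+
  define A where "A m = {x. s x (fst (prod_decode m)) = snd (prod_decode m)}" for m
  have "{x \<in> space borel. s x (fst (prod_decode m)) = snd (prod_decode m)} \<in> sets borel" for m
    by measurable
  then have "coded (A m)" for m unfolding A_def by (intro coded_borel) simp
  then obtain c v where c: "wf_code c" "valuation c v" "\<And>m. v (prod_encode (m, 0)) = A m"
    using coded_family[of A] by blast
  have ev: "e (digit_node n k) \<noteq> 0 \<longleftrightarrow> s x n = k" if "evaluation c x e" for x e n k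
    using that by (simp add: evaluation_iff_valuation[OF c(1,2)] digit_node_def c(3) A_def)
  have "selector_code E c f x y z e e' w" for f x y z e e' w
    unfolding selector_code_def
  proof (intro conjI)
    show "\<not> (\<forall>n. child c (f n) (f (Suc n)))" using c(1) unfolding wf_code_def by blast
    show "(x, x) \<in> E" using E(2) by (simp add: equiv_def refl_on_def)
    show "(x, y) \<in> E \<longrightarrow> (y, x) \<in> E" using E(2) unfolding equiv_def sym_def by blast
    show "(x, y) \<in> E \<and> (y, z) \<in> E \<longrightarrow> (x, z) \<in> E" using E(2) unfolding equiv_def trans_def by blast
    show "evaluation c x e \<longrightarrow> (\<forall>n. \<exists>k. e (digit_node n k) \<noteq> 0)" using ev by blast
    show "evaluation c x e \<and> (\<forall>n. e (digit_node n (w n)) \<noteq> 0) \<longrightarrow> (w, x) \<in> E"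
    proof
      assume "evaluation c x e \<and> (\<forall>n. e (digit_node n (w n)) \<noteq> 0)"
      then have "w = s x" using ev by (auto simp: fun_eq_iff)
      then show "(w, x) \<in> E" using sE(1) by simp
    qed
    show "evaluation c x e \<and> evaluation c y e' \<and> (x, y) \<in> E \<longrightarrow>
      (\<forall>n k. e (digit_node n k) \<noteq> 0 \<longleftrightarrow> e' (digit_node n k) \<noteq> 0)"
      using ev sE(2) by metis
  qed
  then show "closed E \<and> (\<exists>c. \<forall>f x y z e e' w. selector_code E c f x y z e e' w)" using E(1) by blast
next
  assume "closed E \<and> (\<exists>c. \<forall>f x y z e e' w. selector_code E c f x y z e e' w)"
  then obtain c where E: "closed E" and c: "\<And>f x y z e e' w. selector_code E c f x y z e e' w" by blast
  note c' = c[unfolded selector_code_def]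
  have "wf_code c" unfolding wf_code_def using c' by blast
  then obtain v where v: "valuation c v" using wf_code_valuation by blast
  note [measurable] = valuation_borel[OF \<open>wf_code c\<close> v]
  define e where "e x = (\<lambda>i. if x \<in> v i then 1 else 0 :: nat)" for x
  have e: "evaluation c x (e x)" for x
    unfolding evaluation_iff_valuation[OF \<open>wf_code c\<close> v] e_def by simp
  define s where "s x = (\<lambda>n. LEAST k. x \<in> v (digit_node n k))" for x
  have "s \<in> borel \<rightarrow>\<^sub>M borel" unfolding measurable_baire_iff s_def by measurable
  moreover have "(s x, x) \<in> E" for x
  proof -
    \<comment> \<open>The code offers at least one digit at each place, and every sequence of
      offered digits is related to \<open>x\<close>; taking the least ones is a Borel
      choice.\<close>
    have "\<exists>k. x \<in> v (digit_node n k)" for n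
      using c' e[of x] unfolding e_def by (metis (mono_tags, lifting))
    then have "x \<in> v (digit_node n (s x n))" for n unfolding s_def by (rule LeastI_ex)
    then have "\<forall>n. e x (digit_node n (s x n)) \<noteq> 0" by (simp add: e_def)
    then show ?thesis using c' e by blast
  qed
  moreover have "s x = s y" if "(x, y) \<in> E" for x y
  proof -
    have "\<forall>n k. e x (digit_node n k) \<noteq> 0 \<longleftrightarrow> e y (digit_node n k) \<noteq> 0" using c' e that by blast
    then have "x \<in> v (digit_node n k) \<longleftrightarrow> y \<in> v (digit_node n k)" for n k
      by (auto simp: e_def split: if_splits)
    then show ?thesis by (simp add: s_def)
  qed
  ultimately have "borel_selector E s" unfolding borel_selector_def by blast
  moreover have "equiv UNIV E"
  proof (rule equivI)
    show "refl E" using c' unfolding refl_on_def by blast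
    show "sym E" using c' unfolding sym_def by blast
    show "trans E" using c' unfolding trans_def by blast
  qed simp
  ultimately show "E \<in> Sel" using E by (auto simp: Sel_def effros_def space_measure_of_conv)
qed

section \<open>Borel complexity of the matrix\<close>

lemma measurable_baire_app:
  assumes [measurable]: "f \<in> M \<rightarrow>\<^sub>M (borel :: baire measure)" "a \<in> M \<rightarrow>\<^sub>M count_space UNIV"
  shows "(\<lambda>q. f q (a q)) \<in> M \<rightarrow>\<^sub>M count_space UNIV"
  by (rule measurable_compose_countable[of "\<lambda>i q. f q i", OF measurable_compose[OF assms(1) measurable_coord] assms(2)])

lemma pred_child:
  assumes [measurable]: "c \<in> M \<rightarrow>\<^sub>M borel" "a \<in> M \<rightarrow>\<^sub>M count_space UNIV" "b \<in> M \<rightarrow>\<^sub>M count_space UNIV"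
  shows "Measurable.pred M (\<lambda>q. child (c q) (a q) (b q))"
proof -
  have [measurable]: "(\<lambda>q. sn (c q) (prod_encode (a q, b q))) \<in> M \<rightarrow>\<^sub>M count_space UNIV"
    by (rule measurable_baire_app) measurable
  show ?thesis unfolding child_def by measurable
qed

lemma pred_evaluation:
  assumes [measurable]: "c \<in> M \<rightarrow>\<^sub>M borel" "x \<in> M \<rightarrow>\<^sub>M borel" "e \<in> M \<rightarrow>\<^sub>M borel"
  shows "Measurable.pred M (\<lambda>q. evaluation (c q) (x q) (e q))"
proof -
  have [measurable]: "Measurable.pred M (\<lambda>q. child (c q) i j)" for i j
    by (rule pred_child) measurable
  have [measurable]: "Measurable.pred M (\<lambda>q. x q \<in> basic m)" for m
    unfolding basic_def mem_Collect_eq by measurable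
  \<comment> \<open>Splitting by the countably many values of the label leaves a fixed basic set in
    each case.\<close>
  have "Measurable.pred M (\<lambda>q. \<exists>m. fs (c q) i = m \<and> x q \<in> basic m)" for i
    by measurable
  then have [measurable]: "Measurable.pred M (\<lambda>q. x q \<in> basic (fs (c q) i))" for i by simp
  show ?thesis unfolding evaluation_def by measurable
qed

text \<open>The seven points quantified after the code are packed into the columns of one
  \<open>t\<close>, so that a single universal quantifier over a Borel matrix remains.\<close>

lemma Sel_Sigma12: "Sel \<in> Sigma12 (effros :: (baire \<times> baire) set measure)"
proof -
  let ?M = "(effros \<Otimes>\<^sub>M (borel :: baire measure)) \<Otimes>\<^sub>M (borel :: baire measure)"
  define S where "S E c t \<longleftrightarrow>
    selector_code E c (col t 0) (col t 1) (col t 2) (col t 3) (col t 4) (col t 5) (col t 6)" for E c t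
  have S_all: "(\<forall>t. S E c t) \<longleftrightarrow> (\<forall>f x y z e e' w. selector_code E c f x y z e e' w)" for E c
  proof (intro iffI allI)
    fix f x y z e e' w assume "\<forall>t. S E c t"
    then have "S E c (cols (\<lambda>i. [f, x, y, z, e, e', w] ! i))" by blast
    then show "selector_code E c f x y z e e' w"
      unfolding S_def col_cols by (simp add: eval_nat_numeral)
  qed (simp add: S_def)
  have [measurable]: "Measurable.pred ?M (\<lambda>q. S (fst (fst q)) (snd (fst q)) (snd q))"
  proof -
    have E: "(\<lambda>q. fst (fst q)) \<in> ?M \<rightarrow>\<^sub>M effros" by measurable
    have c [measurable]: "(\<lambda>q. snd (fst q)) \<in> ?M \<rightarrow>\<^sub>M borel" by measurable
    have t [measurable]: "(\<lambda>q. col (snd q) i) \<in> ?M \<rightarrow>\<^sub>M borel" for i by measurable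
    have t' [measurable]: "(\<lambda>q. col (snd q) i n) \<in> ?M \<rightarrow>\<^sub>M count_space UNIV" for i n
      by (rule measurable_compose[OF t measurable_coord])
    note [measurable] = pred_mem_effros[OF E t t] pred_evaluation[OF c t t]
      pred_child[OF c t' t']
    have [measurable]: "(\<lambda>q. col (snd q) i (digit_node n (col (snd q) j n))) \<in> ?M \<rightarrow>\<^sub>M count_space UNIV" for i j n
      by (rule measurable_baire_app[OF t measurable_compose[OF t' measurable_count_space]])
    show ?thesis unfolding S_def selector_code_def by measurable
  qed
  define Q where "Q = {q \<in> space ?M. \<not> S (fst (fst q)) (snd (fst q)) (snd q)}"
  have "Q \<in> sets ?M" unfolding Q_def by measurable
  moreover have "Sel = fst ` (space (effros \<Otimes>\<^sub>M (borel :: baire measure)) - fst ` Q)"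
  proof -
    have "(\<exists>t. ((E, c), t) \<in> Q) \<longleftrightarrow> closed E \<and> \<not> (\<forall>t. S E c t)" for E c
      unfolding Q_def by (simp add: space_pair_measure effros_def space_measure_of_conv)
    then have "E \<in> fst ` (space (effros \<Otimes>\<^sub>M (borel :: baire measure)) - fst ` Q) \<longleftrightarrow>
        closed E \<and> (\<exists>c. \<forall>t. S E c t)" for E
      by (simp add: mem_fst_image space_pair_measure effros_def space_measure_of_conv) blast
    then show ?thesis by (intro set_eqI) (simp add: Sel_iff_selector_code S_all)
  qed
  ultimately show ?thesis unfolding Sigma12_def Pi11_def Sigma11_def by blast
qed

theorem mainTheorem17:
  shows "Sigma12_complete TYPE('y) (effros :: (baire \<times> baire) set measure) Sel"
  unfolding Sigma12_complete_def using Sel_Sigma12 Sel_hard by blast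

end
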